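(* Let $P$ be a $\overline{\mathrm{TN}}$ weak upper homogeneous (wupho) poset. Then, for each integer $n$ with $0\le n\le \rho(P)$, all zeros of the $n$th chain polynomial $p_n(t)$ of $P$ are real and located in the interval $[-1,0]$. Moreover $p_n(t)\prec p_{n+1}(t)$ whenever $n+1\le\rho(P)$.
   Context: For a poset $P$, the quasi-rank function is $\rho(x)=\max\{k:x_0<x_1<\cdots<x_k=x,\ x_i\in P\}$, assumed finite for each $x$; $\rho(P)=\sup_{x\in P}\rho(x)\in\mathbb{N}\cup\{\infty\}$. $P$ is weak upper homogeneous (wupho) if it has finitely many elements of each quasi-rank and, for all $x,y\in P$ with $\rho(x)=\rho(y)$, $|\{z\in P:x\le z,\ \rho(z)=n\}|=|\{z\in P:y\le z,\ \rho(z)=n\}|$ for each $n\ge\rho(x)$. For a wupho poset $P$ define $\overline R(P)=(\overline r_{n,k})_{n,k=0}^N$, $N=\rho(P)$, by $\overline r_{n,k}=|\{z\in P:x\le z,\ \rho(z)=n\}|$, where $x\in P$ is a fixed element with $\rho(x)=k$ (so $\overline R(P)$ is lower triangular with unit diagonal). $P$ is $\overline{\mathrm{TN}}$ if $\overline R(P)$ is totally nonnegative, i.e. all its minors are nonnegative. The $n$th chain polynomial of the wupho poset $P$ is $p_0(t)=1$ and, for $n\ge1$, $$p_n(t)=\sum_{j\ge1}|\{x=x_0<x_1<\cdots<x_j:\rho(x_j)=n\}|\,t^j,$$ where $x$ is a fixed minimal element of $P$; equivalently $p_n(t)=t\sum_{k=0}^{n-1}\overline r_{n,k}p_k(t)$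 for $n\ge1$. Interlacing: for real-rooted $f,g$ with positive leading coefficients and zeros $\cdots\le\alpha_2\le\alpha_1$ and $\cdots\le\beta_2\le\beta_1$, $f\prec g$ means $\cdots\le\alpha_2\le\beta_2\le\alpha_1\le\beta_1$; in particular $\deg g\in\{\deg f,\deg f+1\}$. *)

theory Defs
  imports
    "Jordan_Normal_Form.Determinant"
    "HOL-Library.Extended_Nat"
    "HOL-Library.Multiset"
    "HOL-Computational_Algebra.Polynomial"
    Complex_Main
begin

(* A poset is a carrier set P in a type of class order, with the induced order. *)

definition qrank_set :: "'a::order set \<Rightarrow> 'a \<Rightarrow> nat set" where
  "qrank_set P x =
     {k. \<exists>c. length c = Suc k \<and> set c \<subseteq> P \<and> sorted_wrt (<) c \<and> last c = x}"

definition qrank :: "'a::order set \<Rightarrow> 'a \<Rightarrow> nat" where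
  "qrank P x = Max (qrank_set P x)"

definition qrank_poset :: "'a::order set \<Rightarrow> enat" where
  "qrank_poset P = (SUP x\<in>P. enat (qrank P x))"

definition upper_level :: "'a::order set \<Rightarrow> 'a \<Rightarrow> nat \<Rightarrow> 'a set" where
  "upper_level P x n = {z \<in> P. x \<le> z \<and> qrank P z = n}"

(* The first conjunct is the standing assumption that quasi-ranks are finite;
   without it the maximum in qrank has no meaning. *)
definition wupho :: "'a::order set \<Rightarrow> bool" where
  "wupho P \<longleftrightarrow>
     (\<forall>x\<in>P. finite (qrank_set P x)) \<and>
     (\<forall>n. finite {x \<in> P. qrank P x = n}) \<and>
     (\<forall>x\<in>P. \<forall>y\<in>P. qrank P x = qrank P y \<longrightarrow>
        (\<forall>n\<ge>qrank P x. card (upper_level P x n) = card (upper_level P y n)))"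

(* Meaningful for n, k \<le> qrank_poset P only, where an element of quasi-rank k exists;
   by Rbar_eq the choice is immaterial. *)
definition Rbar :: "'a::order set \<Rightarrow> nat \<Rightarrow> nat \<Rightarrow> nat" where
  "Rbar P n k = card (upper_level P (SOME x. x \<in> P \<and> qrank P x = k) n)"

lemma Rbar_eq:
  assumes "wupho P" "x \<in> P" "qrank P x = k" "k \<le> n"
  shows "Rbar P n k = card (upper_level P x n)"
proof -
  let ?y = "SOME y. y \<in> P \<and> qrank P y = k"
  have "?y \<in> P \<and> qrank P ?y = k"
    by (rule someI[of "\<lambda>y. y \<in> P \<and> qrank P y = k" x]) (simp add: assms)
  then have y: "?y \<in> P" "qrank P ?y = k" by simp_all
  have "\<forall>x\<in>P. \<forall>y\<in>P. qrank P x = qrank P y \<longrightarrow>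
      (\<forall>n\<ge>qrank P x. card (upper_level P x n) = card (upper_level P y n))"
    using assms(1) unfolding wupho_def by (rule conjunct2[OF conjunct2])
  from this[rule_format, OF y(1) assms(2), of n] show ?thesis
    unfolding Rbar_def using y(2) assms(3,4) by simp
qed

(* The matrix is indexed by all naturals up to N, and by all naturals if N is infinite;
   f and g enumerate the chosen rows and columns of an m by m minor. *)
definition totally_nonneg :: "enat \<Rightarrow> (nat \<Rightarrow> nat \<Rightarrow> real) \<Rightarrow> bool" where
  "totally_nonneg N A \<longleftrightarrow>
     (\<forall>m f g. strict_mono_on {..<m} f \<and> strict_mono_on {..<m} g \<and>
        (\<forall>i<m. enat (f i) \<le> N \<and> enat (g i) \<le> N) \<longrightarrow>
        det (mat m m (\<lambda>(i, j). A (f i) (g j))) \<ge> 0)"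

definition TN_bar :: "'a::order set \<Rightarrow> bool" where
  "TN_bar P \<longleftrightarrow> totally_nonneg (qrank_poset P) (\<lambda>n k. real (Rbar P n k))"

definition minimal_in :: "'a::order set \<Rightarrow> 'a \<Rightarrow> bool" where
  "minimal_in P x \<longleftrightarrow> x \<in> P \<and> (\<forall>y\<in>P. \<not> y < x)"

definition chains_from :: "'a::order set \<Rightarrow> 'a \<Rightarrow> nat \<Rightarrow> nat \<Rightarrow> 'a list set" where
  "chains_from P x j n =
     {c. length c = Suc j \<and> set c \<subseteq> P \<and> sorted_wrt (<) c \<and> hd c = x \<and> qrank P (last c) = n}"

(* A chain with j strict steps ends in quasi-rank at least j, so chains_from P x j n is
   empty for j > n (lemma chains_from_empty) and the sum over all j \<ge> 1 stops at j = n. *)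
definition chain_poly :: "'a::order set \<Rightarrow> 'a \<Rightarrow> nat \<Rightarrow> real poly" where
  "chain_poly P x n =
     (if n = 0 then 1 else \<Sum>j=1..n. monom (real (card (chains_from P x j n))) j)"

lemma chains_from_empty:
  assumes "wupho P" "n < j"
  shows "chains_from P x j n = {}"
proof (rule ccontr)
  assume "chains_from P x j n \<noteq> {}"
  then obtain c where c: "length c = Suc j" "set c \<subseteq> P" "sorted_wrt (<) c"
    "qrank P (last c) = n"
    unfolding chains_from_def by auto
  from c(1) have "c \<noteq> []" by auto
  with c(2) have "last c \<in> P" using last_in_set by blast
  with assms(1) have "finite (qrank_set P (last c))" unfolding wupho_def by blast
  moreover have "j \<in> qrank_set P (last c)"
    unfolding qrank_set_def mem_Collect_eq using c by (intro exI[of _ c] conjI refl)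
  ultimately have "j \<le> Max (qrank_set P (last c))" by (rule Max_ge)
  then have "j \<le> n" using c(4) unfolding qrank_def by simp
  with assms(2) show False by simp
qed

definition real_rooted :: "real poly \<Rightarrow> bool" where
  "real_rooted p \<longleftrightarrow> (\<forall>z::complex. poly (map_poly complex_of_real p) z = 0 \<longrightarrow> z \<in> \<real>)"

(* Zeros listed with multiplicity in weakly decreasing order. *)
definition zeros_desc :: "real poly \<Rightarrow> real list" where
  "zeros_desc p = rev (sorted_list_of_multiset (proots p))"

(* With \<alpha>, \<beta> the zeros of f, g in decreasing order, indexed from 0, the chain
   \<dots> \<le> \<alpha>_1 \<le> \<beta>_1 \<le> \<alpha>_0 \<le> \<beta>_0 exhausts both lists. *)
definition interlaces :: "real poly \<Rightarrow> real poly \<Rightarrow> bool" (infix "\<prec>\<^sub>I" 50) where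
  "f \<prec>\<^sub>I g \<longleftrightarrow>
     real_rooted f \<and> real_rooted g \<and> lead_coeff f > 0 \<and> lead_coeff g > 0 \<and>
     degree g \<in> {degree f, degree f + 1} \<and>
     (\<forall>i<degree f. zeros_desc f ! i \<le> zeros_desc g ! i) \<and>
     (\<forall>i. i + 1 < degree g \<longrightarrow> zeros_desc g ! (i + 1) \<le> zeros_desc f ! i)"

end

theory Submission
  imports "HOL-Analysis.Complex_Transcendental" "Jordan_Normal_Form.Char_Poly" Defs
begin

text \<open>
  Let \<open>A\<close> be the matrix of the numbers \<open>r_{n,k}\<close>. If all minors of \<open>A\<close> on consecutive rows
  and initial columns are positive, Neville elimination writes row \<open>n\<close> of \<open>A\<close> as the end of a
  chain \<open>R_{n,k} = R_{n,k+1} + \<lambda>_{n,k} R_{n-1,k}\<close> with \<open>\<lambda>_{n,k} > 0\<close>, \<open>R_{n,0}\<close> the row itself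
  and \<open>R_{n,n}\<close> a unit vector. Pairing the rows \<open>R_{n,k}\<close> with the values \<open>p_j(z)\<close> gives numbers
  \<open>q_{n,k}\<close> with \<open>q_{n,n} = p_n(z)\<close> and \<open>z q_{n,0} = (1 + z) q_{n,n}\<close>, and hence
  \<open>q_{n,j} = z \<Sum>_{k<j} \<lambda>_{n,k} q_{n-1,k} + (1 + z) \<Sum>_{j\<le>k<n} \<lambda>_{n,k} q_{n-1,k}\<close>.
  For \<open>Im z > 0\<close> induction on \<open>n\<close> shows that \<open>q_{n,0}, \<dots>, q_{n,n}\<close> are nonzero, that their
  arguments increase, and that they stay within the angle \<open>arg (z / (1 + z))\<close>; hence \<open>p_n(z) \<noteq> 0\<close>
  and \<open>Im (p_{n+1}(z) * cnj (p_n(z))) \<ge> 0\<close>. For real \<open>z\<close> outside \<open>[-1, 0]\<close> all terms of the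
  recursion have the same sign.

  A general totally nonnegative \<open>A\<close> is a limit of such matrices, obtained by repeatedly adding
  \<open>\<epsilon>\<close> times the preceding row to each row. The location of the zeros survives the limit because
  zeros in \<open>[-1, 0]\<close> force \<open>\<bar>p(z)\<bar> \<ge> lc * dist (z, [-1, 0])^n\<close>. Finally, the inequality on the upper
  half plane says that the difference of the arguments of \<open>p_{n+1}\<close> and \<open>p_n\<close> stays in \<open>[0, \<pi>]\<close>;
  approaching the real axis, this difference counts the zeros to the right, which is interlacing.
\<close>

section \<open>Interlacing from the upper half plane\<close>

lemma poly_of_real_mult:
  "poly (map_poly complex_of_real (p * q)) z
    = poly (map_poly complex_of_real p) z * poly (map_poly complex_of_real q) z"
proof -
  interpret map_poly_comm_ring_hom complex_of_real ..
  show ?thesis by (simp add: hom_mult)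
qed

lemma poly_of_real_smult:
  "poly (map_poly complex_of_real (Polynomial.smult c p)) z
    = of_real c * poly (map_poly complex_of_real p) z"
  by (simp add: of_real_hom.map_poly_hom_smult)

text \<open>Induction on the degree: the fundamental theorem of algebra yields a complex zero, which
  is real by hypothesis, and the quotient by its linear factor is again real-rooted.\<close>

lemma real_rooted_factor_mset:
  fixes p :: "real poly"
  assumes "real_rooted p" "p \<noteq> 0"
  shows "\<exists>M. size M = degree p \<and> p = Polynomial.smult (lead_coeff p) (\<Prod>x\<in>#M. [:- x, 1:])"
  using assms
proof (induction "degree p" arbitrary: p)
  case 0
  then obtain c where "p = [:c:]" by (metis degree_eq_zeroE)
  then show ?case using 0 by (intro exI[of _ "{#}"]) (simp add: one_pCons)
next
  case (Suc n)
  have "degree (map_poly complex_of_real p) = Suc n" using Suc.hyps(2) by simp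
  then have "\<not> constant (poly (map_poly complex_of_real p))" by (simp add: constant_degree)
  then obtain z where z: "poly (map_poly complex_of_real p) z = 0"
    using fundamental_theorem_of_algebra by blast
  with Suc.prems(1) obtain r where r: "z = complex_of_real r"
    unfolding real_rooted_def by (metis Reals_cases)
  have "poly p r = 0" using z unfolding r by simp
  then obtain q where q: "p = [:- r, 1:] * q" by (metis poly_eq_0_iff_dvd dvdE)
  have q0: "q \<noteq> 0" using Suc.prems(2) q by auto
  have dq: "n = degree q" using Suc.hyps(2) q0 unfolding q
    by (subst (asm) degree_mult_eq) auto
  have rq: "real_rooted q" unfolding real_rooted_def
  proof (intro allI impI)
    fix w assume "poly (map_poly complex_of_real q) w = 0"
    then have "poly (map_poly complex_of_real p) w = 0"
      unfolding q poly_of_real_mult by simp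
    then show "w \<in> \<real>" using Suc.prems(1) unfolding real_rooted_def by blast
  qed
  obtain M where M: "size M = degree q" "q = Polynomial.smult (lead_coeff q) (\<Prod>x\<in>#M. [:- x, 1:])"
    using Suc.hyps(1)[OF dq rq q0] by blast
  have lc: "lead_coeff p = lead_coeff q" unfolding q by (simp only: lead_coeff_mult) simp
  show ?case
  proof (intro exI[of _ "add_mset r M"] conjI)
    show "size (add_mset r M) = degree p" using M(1) dq Suc.hyps(2) by simp
    show "p = Polynomial.smult (lead_coeff p) (\<Prod>x\<in>#add_mset r M. [:- x, 1:])"
      unfolding lc by (subst q, subst M(2)) simp
  qed
qed

text \<open>The multiset of linear factors is recovered from the polynomial, because
  \<open>proots\<close> turns products into sums of multisets.\<close>

lemma real_rooted_decompose:
  fixes p :: "real poly"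
  assumes "real_rooted p" "p \<noteq> 0"
  shows "size (proots p) = degree p"
    and "p = Polynomial.smult (lead_coeff p) (\<Prod>x\<in>#proots p. [:- x, 1:])"
proof -
  obtain M where M: "size M = degree p" "p = Polynomial.smult (lead_coeff p) (\<Prod>x\<in>#M. [:- x, 1:])"
    using real_rooted_factor_mset[OF assms] by blast
  have "proots p = proots (\<Prod>x\<in>#M. [:- x, 1:])"
    using assms(2) by (subst M(2)) (simp only: proots_smult leading_coeff_0_iff not_False_eq_True)
  also have "\<dots> = \<Sum>\<^sub># (image_mset proots {#[:- x, 1:]. x \<in># M#})"
    using proots_prod_mset[of "{#[:- x, 1:]. x \<in># M#}"] by fastforce
  also have "\<dots> = M" by (induction M) auto
  finally show "size (proots p) = degree p"
    "p = Polynomial.smult (lead_coeff p) (\<Prod>x\<in>#proots p. [:- x, 1:])" using M by simp_all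
qed

lemma poly_of_real_real_rooted:
  fixes p :: "real poly"
  assumes "real_rooted p" "p \<noteq> 0"
  shows "poly (map_poly complex_of_real p) z =
    of_real (lead_coeff p) * poly (map_poly complex_of_real (\<Prod>a\<in>#proots p. [:- a, 1:])) z"
  by (subst real_rooted_decompose(2)[OF assms]) (rule poly_of_real_smult)

section \<open>Arguments along vertical lines\<close>

text \<open>The argument, in \<open>(0, pi)\<close>, of \<open>x + y * \<i> - a\<close> for \<open>y > 0\<close>.\<close>
definition ang :: "real \<Rightarrow> real \<Rightarrow> real \<Rightarrow> real" where
  "ang x y a = pi / 2 - arctan ((x - a) / y)"

lemma cis_ang:
  assumes "y > 0"
  shows "\<exists>r>0. Complex x y - of_real a = of_real r * cis (ang x y a)"
proof -
  let ?u = "(x - a) / y"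
  have pos: "sqrt (1 + ?u\<^sup>2) > 0" by (simp add: add_pos_nonneg)
  have "Complex x y - of_real a = of_real (y * sqrt (1 + ?u\<^sup>2)) * cis (ang x y a)"
  proof (rule complex_eqI)
    have "cos (ang x y a) = ?u / sqrt (1 + ?u\<^sup>2)"
      unfolding ang_def by (simp add: cos_diff sin_arctan)
    then show "Re (Complex x y - of_real a) = Re (of_real (y * sqrt (1 + ?u\<^sup>2)) * cis (ang x y a))"
      using assms pos by simp
    have "sin (ang x y a) = 1 / sqrt (1 + ?u\<^sup>2)"
      unfolding ang_def by (simp add: sin_diff cos_arctan)
    then show "Im (Complex x y - of_real a) = Im (of_real (y * sqrt (1 + ?u\<^sup>2)) * cis (ang x y a))"
      using assms pos by simp
  qed
  then show ?thesis using assms pos by (metis mult_pos_pos)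
qed

text \<open>Polar forms multiply, so the angles of the linear factors add up. Unlike the principal
  argument, this sum depends continuously on \<open>y\<close>.\<close>

lemma cis_ang_poly:
  fixes p :: "real poly"
  assumes "real_rooted p" "lead_coeff p > 0" "y > 0"
  shows "\<exists>r>0. poly (map_poly complex_of_real p) (Complex x y)
    = of_real r * cis (\<Sum>a\<in>#proots p. ang x y a)"
proof -
  have "\<exists>r>0. poly (map_poly complex_of_real (\<Prod>a\<in>#M. [:- a, 1:])) (Complex x y)
    = of_real r * cis (\<Sum>a\<in>#M. ang x y a)" for M
  proof (induction M)
    case empty
    then show ?case by (intro exI[of _ 1]) simp
  next
    case (add a M)
    then obtain r s where rs: "r > 0" "s > 0"
      "poly (map_poly complex_of_real (\<Prod>a\<in>#M. [:- a, 1:])) (Complex x y)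
        = of_real r * cis (\<Sum>a\<in>#M. ang x y a)"
      "Complex x y - of_real a = of_real s * cis (ang x y a)"
      using cis_ang[OF assms(3)] by metis
    have "poly (map_poly complex_of_real (\<Prod>a\<in>#add_mset a M. [:- a, 1:])) (Complex x y) =
      (Complex x y - of_real a) * poly (map_poly complex_of_real (\<Prod>a\<in>#M. [:- a, 1:])) (Complex x y)"
      by (simp only: image_mset_add_mset prod_mset.add_mset poly_of_real_mult) simp
    also have "\<dots> = of_real (r * s) * cis (\<Sum>a\<in>#add_mset a M. ang x y a)"
      unfolding rs by (simp add: cis_mult[symmetric])
    finally show ?case using rs(1,2) by (metis mult_pos_pos)
  qed
  then obtain r where r: "r > 0"
    "poly (map_poly complex_of_real (\<Prod>a\<in>#proots p. [:- a, 1:])) (Complex x y)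
    = of_real r * cis (\<Sum>a\<in>#proots p. ang x y a)" by blast
  have "p \<noteq> 0" using assms(2) by auto
  from poly_of_real_real_rooted[OF assms(1) this] have "poly (map_poly complex_of_real p) (Complex x y) =
      of_real (lead_coeff p * r) * cis (\<Sum>a\<in>#proots p. ang x y a)"
    using r(2) by simp
  then show ?thesis using r(1) assms(2) by (metis mult_pos_pos)
qed

lemma ang_tendsto_at_top: "((\<lambda>y. ang x y a) \<longlongrightarrow> pi / 2) at_top"
proof -
  have "((\<lambda>y::real. (x - a) / y) \<longlongrightarrow> 0) at_top"
    by (intro tendsto_divide_0[OF tendsto_const] filterlim_at_top_imp_at_infinity filterlim_ident)
  then have "((\<lambda>y. ang x y a) \<longlongrightarrow> pi / 2 - arctan 0) at_top"
    unfolding ang_def by (intro tendsto_intros)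
  then show ?thesis by simp
qed

text \<open>On approaching the real axis at \<open>x\<close>, a zero to the right of
  \<open>x\<close> contributes \<open>pi\<close> and a zero to the left contributes 0; angle sums
  thus count zeros.\<close>

lemma ang_tendsto_at_right:
  assumes "x \<noteq> a"
  shows "((\<lambda>y. ang x y a) \<longlongrightarrow> (if x < a then pi else 0)) (at_right 0)"
proof (cases "x < a")
  case True
  have "filterlim (\<lambda>y::real. (x - a) * inverse y) at_bot (at_right 0)"
    using True by (intro filterlim_tendsto_neg_mult_at_bot[OF tendsto_const _ filterlim_inverse_at_top_right]) simp
  then have "((\<lambda>y. arctan ((x - a) * inverse y)) \<longlongrightarrow> - (pi / 2)) (at_right 0)"
    by (rule filterlim_compose[OF tendsto_arctan_at_bot, of "\<lambda>y. (x - a) * inverse y"])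
  from tendsto_diff[OF tendsto_const[of "pi / 2"] this]
  show ?thesis using True assms unfolding ang_def divide_inverse[of "x - a"] by simp
next
  case False
  have "filterlim (\<lambda>y::real. (x - a) * inverse y) at_top (at_right 0)"
    using False assms by (intro filterlim_tendsto_pos_mult_at_top[OF tendsto_const _ filterlim_inverse_at_top_right]) simp
  then have "((\<lambda>y. arctan ((x - a) * inverse y)) \<longlongrightarrow> pi / 2) (at_right 0)"
    by (rule filterlim_compose[OF tendsto_arctan_at_top, of "\<lambda>y. (x - a) * inverse y"])
  from tendsto_diff[OF tendsto_const[of "pi / 2"] this]
  show ?thesis using False assms unfolding ang_def divide_inverse[of "x - a"] by simp
qed

lemma tendsto_sum_mset:
  fixes f :: "'b \<Rightarrow> 'a \<Rightarrow> real"
  assumes "\<And>a. a \<in># M \<Longrightarrow> ((\<lambda>y. f y a) \<longlongrightarrow> l a) F"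
  shows "((\<lambda>y. \<Sum>a\<in>#M. f y a) \<longlongrightarrow> (\<Sum>a\<in>#M. l a)) F"
  using assms by (induction M) (auto intro!: tendsto_add)

lemma size_filter_mset_eq_sum: "real (size (filter_mset P M)) * c = (\<Sum>a\<in>#M. if P a then c else 0)"
  by (induction M) (auto simp: algebra_simps)

text \<open>The image of \<phi> is connected and contains values in \<open>{0<..<pi}\<close>.
  Leaving \<open>[0, pi]\<close> would force \<phi> through values with negative sine.\<close>

lemma continuous_bounded_if_sin_nonneg:
  fixes \<phi> :: "real \<Rightarrow> real"
  assumes cont: "continuous_on {0<..} \<phi>" and sn: "\<And>y. y > 0 \<Longrightarrow> sin (\<phi> y) \<ge> 0"
    and lim: "(\<phi> \<longlongrightarrow> pi / 2) at_top" and "y > 0"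
  shows "0 \<le> \<phi> y \<and> \<phi> y \<le> pi"
proof -
  have "\<forall>\<^sub>F t in at_top. \<phi> t \<in> {0<..<pi}"
    using pi_gt_zero by (intro topological_tendstoD[OF lim]) auto
  then have "\<forall>\<^sub>F t in at_top. \<phi> t \<in> {0<..<pi} \<and> t > 0"
    by (intro eventually_conj eventually_gt_at_top)
  then obtain t where t: "t > 0" "0 < \<phi> t" "\<phi> t < pi"
    by (auto simp: eventually_at_top_linorder)
  have conn: "connected (\<phi> ` {0<..})" by (intro connected_continuous_image cont) simp
  have *: "s \<in> \<phi> ` {0<..}" if "\<phi> a \<le> s" "s \<le> \<phi> b" "a > 0" "b > 0" for a b s
    using connectedD_interval[OF conn] that by blast
  show ?thesis
  proof (rule ccontr)
    assume "\<not> (0 \<le> \<phi> y \<and> \<phi> y \<le> pi)"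
    then consider "\<phi> y > pi" | "\<phi> y < 0" by linarith
    then show False
    proof cases
      case 1
      \<comment> \<open>The cap at \<open>3 * pi / 2\<close> keeps \<open>s\<close> in the interval
        from \<open>pi\<close> to \<open>2 * pi\<close>, where the sine is negative, even if
        \<open>\<phi> y\<close> lies far beyond.\<close>
      define s where "s = min (\<phi> y) (3 * pi / 2)"
      have "s \<in> \<phi> ` {0<..}" using 1 t assms(4) by (intro *[of t _ y]) (auto simp: s_def)
      moreover have "sin s < 0" using 1 pi_gt_zero by (intro sin_lt_zero) (auto simp: s_def min_def)
      ultimately show False using sn by fastforce
    next
      case 2
      define s where "s = max (\<phi> y) (- pi / 2)"
      have "s \<in> \<phi> ` {0<..}" using 2 t assms(4) by (intro *[of y _ t]) (auto simp: s_def max_def)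
      moreover have "sin (- s) > 0" using 2 pi_gt_zero by (intro sin_gt_zero) (auto simp: s_def max_def)
      ultimately show False using sn by fastforce
    qed
  qed
qed

text \<open>The difference of the angle sums of \<open>g\<close> and \<open>f\<close> on the
  vertical line over \<open>x\<close> is a continuous argument of \<open>g * cnj f\<close>. It tends
  to \<open>pi / 2\<close> at infinity, as the degrees differ by one, so it stays in
  \<open>[0, pi]\<close>. Its limit at the real axis is \<open>pi\<close> times the difference of
  the numbers of zeros beyond \<open>x\<close>.\<close>

lemma root_count_if_Im_nonneg:
  fixes f g :: "real poly"
  assumes rr: "real_rooted f" "real_rooted g" and lc: "lead_coeff f > 0" "lead_coeff g > 0"
    and deg: "degree g = degree f + 1"
    and Im: "\<And>z. Im z > 0 \<Longrightarrow>
      Im (poly (map_poly complex_of_real g) z * cnj (poly (map_poly complex_of_real f) z)) \<ge> 0"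
    and x: "poly f x \<noteq> 0" "poly g x \<noteq> 0"
  shows "size (filter_mset ((<) x) (proots f)) \<le> size (filter_mset ((<) x) (proots g))"
    and "size (filter_mset ((<) x) (proots g)) \<le> size (filter_mset ((<) x) (proots f)) + 1"
proof -
  have nz: "f \<noteq> 0" "g \<noteq> 0" using lc by auto
  let ?S = "\<lambda>p y. \<Sum>a\<in>#proots p. ang x y a"
  let ?N = "\<lambda>p. size (filter_mset ((<) x) (proots p))"
  let ?\<phi> = "\<lambda>y. ?S g y - ?S f y"
  have sn: "sin (?\<phi> y) \<ge> 0" if "y > 0" for y
  proof -
    obtain r s where rs: "r > 0" "s > 0"
      "poly (map_poly complex_of_real f) (Complex x y) = of_real r * cis (?S f y)"
      "poly (map_poly complex_of_real g) (Complex x y) = of_real s * cis (?S g y)"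
      using cis_ang_poly rr lc \<open>y > 0\<close> by metis
    have "0 \<le> Im (of_real s * cis (?S g y) * cnj (of_real r * cis (?S f y)))"
      using Im[of "Complex x y"] that unfolding rs(3,4) by simp
    also have "of_real s * cis (?S g y) * cnj (of_real r * cis (?S f y)) = of_real (s * r) * cis (?\<phi> y)"
      by (simp add: cis_cnj cis_mult)
    also have "Im \<dots> = s * r * sin (?\<phi> y)" by simp
    finally show ?thesis using rs(1,2) by (metis mult_pos_pos zero_le_mult_iff not_less)
  qed
  have cont_ang: "continuous_on {0<..} (\<lambda>y. \<Sum>a\<in>#M. ang x y a)" for M
    by (induction M) (auto simp: ang_def intro!: continuous_intros)
  have cont: "continuous_on {0<..} ?\<phi>" by (intro continuous_on_diff cont_ang)
  have "(?S p \<longlongrightarrow> real (size (proots p)) * (pi / 2)) at_top" for p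
    using tendsto_sum_mset[of "proots p" "ang x" "\<lambda>_. pi / 2" at_top] ang_tendsto_at_top
    by (simp add: sum_mset_constant)
  then have "(?\<phi> \<longlongrightarrow> real (size (proots g)) * (pi / 2) - real (size (proots f)) * (pi / 2)) at_top"
    by (intro tendsto_diff)
  also have "real (size (proots g)) * (pi / 2) - real (size (proots f)) * (pi / 2) = pi / 2"
    using deg by (simp add: real_rooted_decompose(1) rr nz field_simps)
  finally have bnd: "0 \<le> ?\<phi> y \<and> ?\<phi> y \<le> pi" if "y > 0" for y
    using continuous_bounded_if_sin_nonneg[OF cont sn _ that] by blast
  have "(?S p \<longlongrightarrow> real (?N p) * pi) (at_right 0)" if "poly p x \<noteq> 0" for p
    unfolding size_filter_mset_eq_sum
  proof (rule tendsto_sum_mset)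
    fix a assume "a \<in># proots p"
    then have "x \<noteq> a" using that by (cases "p = 0") auto
    then show "((\<lambda>y. ang x y a) \<longlongrightarrow> (if x < a then pi else 0)) (at_right 0)"
      by (rule ang_tendsto_at_right)
  qed
  then have lim: "(?\<phi> \<longlongrightarrow> real (?N g) * pi - real (?N f) * pi) (at_right 0)"
    using x by (intro tendsto_diff) auto
  have ev: "\<forall>\<^sub>F y in at_right (0::real). y > 0" by (simp add: eventually_at_right_less)
  have "0 \<le> real (?N g) * pi - real (?N f) * pi"
    by (rule tendsto_lowerbound[OF lim eventually_mono[OF ev]]) (use bnd in auto)
  moreover have "real (?N g) * pi - real (?N f) * pi \<le> pi"
    by (rule tendsto_upperbound[OF lim eventually_mono[OF ev]]) (use bnd in auto)
  ultimately have "real (?N f) * pi \<le> real (?N g) * pi" "real (?N g) * pi \<le> (real (?N f) + 1) * pi"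
    by (auto simp: algebra_simps)
  then show "?N f \<le> ?N g" "?N g \<le> ?N f + 1" by (auto simp del: of_nat_Suc)
qed

section \<open>From zero counts to interlacing\<close>

lemma sorted_desc_count:
  fixes xs :: "'a::linorder list"
  assumes "sorted_wrt (\<ge>) xs" "i < length xs"
  shows "x < xs ! i \<Longrightarrow> i < size (filter_mset ((<) x) (mset xs))"
    and "xs ! i \<le> x \<Longrightarrow> size (filter_mset ((<) x) (mset xs)) \<le> i"
proof -
  \<comment> \<open>Since the list is decreasing, these positions form an initial segment.\<close>
  let ?J = "{j. j < length xs \<and> x < xs ! j}"
  have eq: "size (filter_mset ((<) x) (mset xs)) = card ?J"
    by (simp add: mset_filter[symmetric] length_filter_conv_card del: mset_filter)
  have mono: "xs ! k \<le> xs ! j" if "j \<le> k" "k < length xs" for j k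
    using assms(1) that by (cases "j = k") (auto simp: sorted_wrt_iff_nth_less)
  show "i < size (filter_mset ((<) x) (mset xs))" if "x < xs ! i"
  proof -
    have "{..i} \<subseteq> ?J" using mono[OF _ assms(2)] assms(2) that by (auto intro: less_le_trans)
    then have "card {..i} \<le> card ?J" by (intro card_mono) auto
    then show ?thesis using eq by simp
  qed
  show "size (filter_mset ((<) x) (mset xs)) \<le> i" if "xs ! i \<le> x"
  proof -
    have "?J \<subseteq> {..<i}" using mono[of i] that by (force simp: not_le[symmetric])
    then have "card ?J \<le> card {..<i}" by (intro card_mono) auto
    then show ?thesis using eq by simp
  qed
qed

lemma exists_nonroot_between:
  fixes p :: "real poly"
  assumes "p \<noteq> 0" "a < b"
  shows "\<exists>x. a < x \<and> x < b \<and> poly p x \<noteq> 0"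
proof -
  have "infinite ({a<..<b} - {x. poly p x = 0})"
    using assms poly_roots_finite[OF assms(1)] by (simp add: Diff_infinite_finite)
  then have "{a<..<b} - {x. poly p x = 0} \<noteq> {}" by (metis finite.emptyI)
  then obtain x where "x \<in> {a<..<b} - {x. poly p x = 0}" by blast
  then show ?thesis by auto
qed

text \<open>If two listed zeros were in the wrong order, a point \<open>x\<close> strictly between
  them and avoiding all zeros of \<open>f * g\<close> would have zero counts that contradict
  \<open>root_count_if_Im_nonneg\<close>.\<close>

lemma interlaces_if_Im_nonneg:
  fixes f g :: "real poly"
  assumes rr: "real_rooted f" "real_rooted g" and lc: "lead_coeff f > 0" "lead_coeff g > 0"
    and deg: "degree g = degree f + 1"
    and Im: "\<And>z. Im z > 0 \<Longrightarrow>
      Im (poly (map_poly complex_of_real g) z * cnj (poly (map_poly complex_of_real f) z)) \<ge> 0"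
  shows "f \<prec>\<^sub>I g"
proof -
  have nz: "f \<noteq> 0" "g \<noteq> 0" using lc by auto
  let ?N = "\<lambda>p x. size (filter_mset ((<) x) (proots p))"
  have mset: "mset (zeros_desc p) = proots p" for p by (simp add: zeros_desc_def)
  have sorted: "sorted_wrt (\<ge>) (zeros_desc p)" for p
    by (simp add: zeros_desc_def sorted_wrt_rev)
  have len: "length (zeros_desc p) = degree p" if "real_rooted p" "p \<noteq> 0" for p
    using real_rooted_decompose(1)[OF that] by (metis mset size_mset)
  note above = sorted_desc_count(1)[OF sorted, unfolded mset]
  note below = sorted_desc_count(2)[OF sorted, unfolded mset]
  have count: "?N f x \<le> ?N g x" "?N g x \<le> ?N f x + 1" if "poly (f * g) x \<noteq> 0" for x
    using root_count_if_Im_nonneg[OF rr lc deg Im, of x] that by auto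
  have "zeros_desc f ! i \<le> zeros_desc g ! i" if "i < degree f" for i
  proof (rule ccontr)
    assume "\<not> ?thesis"
    then obtain x where x: "zeros_desc g ! i < x" "x < zeros_desc f ! i" "poly (f * g) x \<noteq> 0"
      using exists_nonroot_between[of "f * g" "zeros_desc g ! i" "zeros_desc f ! i"] nz by auto
    have "i < ?N f x" using above[of i f x] that x len rr nz by simp
    moreover have "?N g x \<le> i" using below[of i g x] that x len rr nz deg by simp
    ultimately show False using count(1)[OF x(3)] by simp
  qed
  moreover have "zeros_desc g ! (i + 1) \<le> zeros_desc f ! i" if "i + 1 < degree g" for i
  proof (rule ccontr)
    assume "\<not> ?thesis"
    then obtain x where x: "zeros_desc f ! i < x" "x < zeros_desc g ! (i + 1)" "poly (f * g) x \<noteq> 0"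
      using exists_nonroot_between[of "f * g" "zeros_desc f ! i" "zeros_desc g ! (i + 1)"] nz by auto
    have "i + 1 < ?N g x" using above[of "i + 1" g x] that x len rr nz by simp
    moreover have "?N f x \<le> i" using below[of i f x] that x len rr nz deg by simp
    ultimately show False using count(2)[OF x(3)] by simp
  qed
  ultimately show ?thesis unfolding interlaces_def using rr lc deg by auto
qed

section \<open>Perturbation and Neville elimination\<close>

text \<open>Entries are given by a function of row and column, so that a row can be replaced by
  function update.\<close>

abbreviation det_of :: "nat \<Rightarrow> (nat \<Rightarrow> nat \<Rightarrow> real) \<Rightarrow> real" where
  "det_of m r \<equiv> det (Matrix.mat m m (\<lambda>(i, j). r i j))"

text \<open>Each term of the Leibniz formula has exactly one factor from row
  \<open>k\<close>.\<close>

lemma det_of_row_linear: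
  assumes "k < m"
  shows "det_of m (r(k := \<lambda>j. u j + c * v j)) = det_of m (r(k := u)) + c * det_of m (r(k := v))"
proof -
  have leibniz: "det_of m (r(k := w)) =
      (\<Sum>p | p permutes {0..<m}. signof p * (w (p k) * (\<Prod>i\<in>{0..<m} - {k}. r i (p i))))" for w
  proof -
    have "(\<Prod>i=0..<m. Matrix.mat m m (\<lambda>(i, j). (r(k := w)) i j) $$ (i, p i)) =
        w (p k) * (\<Prod>i\<in>{0..<m} - {k}. r i (p i))" if "p permutes {0..<m}" for p
    proof -
      have "p i < m" if "i < m" for i
        using permutes_in_image[OF \<open>p permutes {0..<m}\<close>, of i] that by simp
      then have "(\<Prod>i=0..<m. Matrix.mat m m (\<lambda>(i, j). (r(k := w)) i j) $$ (i, p i)) =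
          (\<Prod>i=0..<m. (r(k := w)) i (p i))" by (intro prod.cong) auto
      also have "\<dots> = (r(k := w)) k (p k) * (\<Prod>i\<in>{0..<m} - {k}. (r(k := w)) i (p i))"
        using assms by (intro prod.remove) auto
      also have "(\<Prod>i\<in>{0..<m} - {k}. (r(k := w)) i (p i)) = (\<Prod>i\<in>{0..<m} - {k}. r i (p i))"
        by (intro prod.cong) auto
      finally show ?thesis by simp
    qed
    then show ?thesis by (subst det_def'[of _ m]) (auto intro!: sum.cong)
  qed
  show ?thesis unfolding leibniz
    by (simp add: sum_distrib_left sum.distrib[symmetric] algebra_simps)
qed

lemma det_of_cong:
  assumes "\<And>i j. i < m \<Longrightarrow> j < m \<Longrightarrow> r i j = r' i j"
  shows "det_of m r = det_of m r'"
  using assms by (intro arg_cong[of _ _ det] eq_matI) auto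

lemma det_of_upper_triangular:
  assumes "\<And>i j. i < m \<Longrightarrow> j < i \<Longrightarrow> r i j = 0"
  shows "det_of m r = (\<Prod>i<m. r i i)"
  by (subst det_upper_triangular[of _ m])
    (use assms in \<open>auto intro!: upper_triangularI prod.cong simp: prod_list_diag_prod atLeast0LessThan\<close>)

lemma det_of_lower_triangular:
  assumes "\<And>i j. i < j \<Longrightarrow> j < m \<Longrightarrow> r i j = 0"
  shows "det_of m r = (\<Prod>i<m. r i i)"
  by (subst det_lower_triangular[of m])
    (use assms in \<open>auto intro!: prod.cong simp: prod_list_diag_prod atLeast0LessThan\<close>)

text \<open>All rows change at once, each by a multiple of the old preceding row: this is left
  multiplication by a lower bidiagonal matrix with unit diagonal. The condition
  \<open>c 0 = 0\<close> leaves row 0 fixed, where \<open>i - 1\<close> is 0 again.\<close>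

lemma det_of_diff_prev_row:
  assumes "c 0 = 0"
  shows "det_of m (\<lambda>i j. r i j - c i * r (i - 1) j) = det_of m r"
proof -
  let ?l = "\<lambda>i k. if k = i then 1 else if Suc k = i then - c i else 0"
  let ?L = "Matrix.mat m m (\<lambda>(i, k). ?l i k)" and ?R = "Matrix.mat m m (\<lambda>(i, j). r i j)"
  have "?L * ?R = Matrix.mat m m (\<lambda>(i, j). r i j - c i * r (i - 1) j)"
  proof (rule eq_matI)
    fix i j
    assume "i < dim_row (Matrix.mat m m (\<lambda>(i, j). r i j - c i * r (i - 1) j))"
      and "j < dim_col (Matrix.mat m m (\<lambda>(i, j). r i j - c i * r (i - 1) j))"
    then have ij: "i < m" "j < m" by auto
    have "(?L * ?R) $$ (i, j) = (\<Sum>k\<in>{0..<m}. ?l i k * r k j)"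
      using ij by (auto simp: scalar_prod_def intro!: sum.cong)
    also have "\<dots> = (\<Sum>k\<in>(if i = 0 then {i} else {i, i - 1}). ?l i k * r k j)"
      using ij by (intro sum.mono_neutral_right) auto
    also have "\<dots> = r i j - c i * r (i - 1) j" using assms by auto
    finally show "(?L * ?R) $$ (i, j) = Matrix.mat m m (\<lambda>(i, j). r i j - c i * r (i - 1) j) $$ (i, j)"
      using ij by simp
  qed auto
  then have "det_of m (\<lambda>i j. r i j - c i * r (i - 1) j) = det (?L * ?R)" by simp
  also have "\<dots> = det ?L * det ?R" by (rule det_mult) auto
  also have "det ?L = 1" by (subst det_of_lower_triangular) auto
  finally show ?thesis by simp
qed

section \<open>Minors after adding multiples of preceding rows\<close>

definition add_prev_row :: "real \<Rightarrow> (nat \<Rightarrow> nat \<Rightarrow> real) \<Rightarrow> nat \<Rightarrow> nat \<Rightarrow> real" where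
  "add_prev_row e A n j = A n j + e * (if n = 0 then 0 else A (n - 1) j)"

text \<open>
  The minor of \<open>add_prev_row e A\<close> in which only the first \<open>s\<close> rows have been modified. Passing from
  \<open>s\<close> to \<open>s + 1\<close> splits it into two minors of the same kind, where the row selection \<open>f\<close>
  may cease to be injective; this is why \<open>f\<close> is only assumed weakly increasing from \<open>s\<close> on.
\<close>
definition part_shift :: "real \<Rightarrow> (nat \<Rightarrow> nat \<Rightarrow> real) \<Rightarrow> nat \<Rightarrow> (nat \<Rightarrow> nat) \<Rightarrow> nat \<Rightarrow> (nat \<Rightarrow> nat) \<Rightarrow> real" where
  "part_shift e A m g s f =
     det_of m (\<lambda>i j. if i < s then add_prev_row e A (f i) (g j) else A (f i) (g j))"

text \<open>Linearity in row \<open>s\<close>. For \<open>f s = 0\<close> there is no preceding row,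
  whereas \<open>f s - 1\<close> would denote row 0 again; hence the case distinction.\<close>

lemma part_shift_Suc:
  assumes "s < m"
  shows "part_shift e A m g (Suc s) f = part_shift e A m g s f +
    (if f s = 0 then 0 else e * part_shift e A m g s (f(s := f s - 1)))"
proof -
  let ?r = "\<lambda>f i j. if i < s then add_prev_row e A (f i) (g j) else A (f i) (g j)"
  have eq: "part_shift e A m g (Suc s) f = det_of m ((?r f)(s := \<lambda>j. add_prev_row e A (f s) (g j)))"
    unfolding part_shift_def by (intro det_of_cong) auto
  show ?thesis
  proof (cases "f s = 0")
    case True
    then show ?thesis unfolding eq unfolding part_shift_def
      by (auto intro!: det_of_cong simp: add_prev_row_def)
  next
    case False
    have "part_shift e A m g (Suc s) f =
        det_of m ((?r f)(s := \<lambda>j. A (f s) (g j) + e * A (f s - 1) (g j)))"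
      unfolding eq using False by (intro det_of_cong) (auto simp: add_prev_row_def)
    also have "\<dots> = det_of m ((?r f)(s := \<lambda>j. A (f s) (g j)))
        + e * det_of m ((?r f)(s := \<lambda>j. A (f s - 1) (g j)))"
      by (rule det_of_row_linear[OF assms])
    also have "det_of m ((?r f)(s := \<lambda>j. A (f s) (g j))) = part_shift e A m g s f"
      unfolding part_shift_def by (intro det_of_cong) auto
    also have "det_of m ((?r f)(s := \<lambda>j. A (f s - 1) (g j))) = part_shift e A m g s (f(s := f s - 1))"
      unfolding part_shift_def by (intro det_of_cong) auto
    finally show ?thesis using False by simp
  qed
qed

text \<open>Both minors in \<open>part_shift_Suc\<close> satisfy the hypotheses for
  \<open>s\<close>: since \<open>f i < f s\<close> for \<open>i < s\<close>, lowering
  \<open>f s\<close> by one keeps \<open>f\<close> weakly increasing. With no row modified, either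
  \<open>f\<close> is strictly increasing and the minor is one of \<open>A\<close>, or two rows
  coincide and it vanishes.\<close>

lemma part_shift_nonneg:
  assumes TN: "totally_nonneg (enat N) A" and e: "e \<ge> 0"
    and g: "strict_mono_on {..<m} g" "\<And>i. i < m \<Longrightarrow> g i \<le> N"
    and s: "s \<le> m" and f: "strict_mono_on {..<s} f" "mono_on {..<m} f" "\<And>i. i < m \<Longrightarrow> f i \<le> N"
  shows "part_shift e A m g s f \<ge> 0"
  using s f
proof (induction s arbitrary: f)
  case 0
  show ?case
  proof (cases "inj_on f {..<m}")
    case True
    then have "strict_mono_on {..<m} f" using 0(3)
      by (auto simp: strict_mono_on_def mono_on_def inj_on_def order.strict_iff_order)
    then show ?thesis
      using TN g 0(4) unfolding part_shift_def totally_nonneg_def by auto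
  next
    case False
    then obtain i j where ij: "i < m" "j < m" "i \<noteq> j" "f i = f j" by (auto simp: inj_on_def)
    have "part_shift e A m g 0 f = 0" unfolding part_shift_def
      by (rule det_identical_rows[OF _ ij(3,1,2)]) (use ij in \<open>auto intro!: eq_vecI\<close>)
    then show ?thesis by simp
  qed
next
  case (Suc s)
  have "0 \<le> part_shift e A m g s f"
    by (rule Suc.IH) (use Suc.prems in \<open>auto simp: strict_mono_on_def\<close>)
  moreover have "0 \<le> part_shift e A m g s (f(s := f s - 1))" if "f s \<noteq> 0"
  proof (rule Suc.IH)
    have less: "f i < f s" if "i < s" for i
      using Suc.prems(2) that by (auto simp: strict_mono_on_def)
    show "strict_mono_on {..<s} (f(s := f s - 1))"
      using Suc.prems(2) by (auto simp: strict_mono_on_def)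
    show "mono_on {..<m} (f(s := f s - 1))"
    proof (rule mono_onI)
      fix a b assume ab: "a \<in> {..<m}" "b \<in> {..<m}" "a \<le> b"
      then have "f a \<le> f b" using Suc.prems(3) by (auto simp: mono_on_def)
      then show "(f(s := f s - 1)) a \<le> (f(s := f s - 1)) b"
        using ab less[of a] by (cases "b = s"; cases "a = s") auto
    qed
    show "(f(s := f s - 1)) i \<le> N" if "i < m" for i
      using Suc.prems(4)[of i] that by auto
  qed (use Suc.prems in auto)
  ultimately show ?case using Suc.prems(1) e by (simp add: part_shift_Suc)
qed

text \<open>Every summand with factor \<open>e\<close> that is dropped in
  \<open>part_shift_Suc\<close> is nonnegative.\<close>

lemma part_shift_ge:
  assumes TN: "totally_nonneg (enat N) A" and e: "e \<ge> 0"
    and g: "strict_mono_on {..<m} g" "\<And>i. i < m \<Longrightarrow> g i \<le> N"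
    and f: "strict_mono_on {..<m} f" "\<And>i. i < m \<Longrightarrow> f i \<le> N"
    and s: "s \<le> m"
  shows "part_shift e A m g 0 f \<le> part_shift e A m g s f"
  using s
proof (induction s)
  case (Suc s)
  have "0 \<le> part_shift e A m g s (f(s := f s - 1))" if "f s \<noteq> 0"
  proof (rule part_shift_nonneg[OF TN e g])
    show "strict_mono_on {..<s} (f(s := f s - 1))"
      using f(1) Suc.prems by (auto simp: strict_mono_on_def)
    show "mono_on {..<m} (f(s := f s - 1))"
    proof (rule mono_onI)
      fix a b assume ab: "a \<in> {..<m}" "b \<in> {..<m}" "a \<le> b"
      then show "(f(s := f s - 1)) a \<le> (f(s := f s - 1)) b"
        using f(1)[THEN strict_mono_onD, of a b]
        by (cases "a = b"; cases "b = s"; cases "a = s") auto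
    qed
    show "(f(s := f s - 1)) i \<le> N" if "i < m" for i using f(2)[of i] that by auto
  qed (use Suc.prems in auto)
  then show ?case using Suc e by (auto simp: part_shift_Suc intro: order.trans)
qed simp

text \<open>The opposite choice to \<open>part_shift_ge\<close>: at each step only the summand with
  factor \<open>e\<close> is kept, so the first \<open>s\<close> selected rows all move up by
  one.\<close>

lemma part_shift_ge_shifted:
  assumes TN: "totally_nonneg (enat N) A" and e: "e \<ge> 0"
    and g: "strict_mono_on {..<m} g" "\<And>i. i < m \<Longrightarrow> g i \<le> N"
    and s: "s \<le> m" and f: "strict_mono_on {..<s} f" "mono_on {..<m} f" "\<And>i. i < m \<Longrightarrow> f i \<le> N"
      "\<And>i. i < s \<Longrightarrow> 0 < f i"
  shows "e ^ s * part_shift e A m g 0 (\<lambda>i. if i < s then f i - 1 else f i) \<le> part_shift e A m g s f"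
  using s f
proof (induction s arbitrary: f)
  case (Suc s)
  let ?f = "f(s := f s - 1)"
  have less: "f i < f s" if "i < s" for i
    using Suc.prems(2) that by (auto simp: strict_mono_on_def)
  have strict: "strict_mono_on {..<s} ?f" "strict_mono_on {..<s} f"
    using Suc.prems(2) by (auto simp: strict_mono_on_def)
  have mono: "mono_on {..<m} ?f"
  proof (rule mono_onI)
    fix a b assume ab: "a \<in> {..<m}" "b \<in> {..<m}" "a \<le> b"
    then have "f a \<le> f b" using Suc.prems(3) by (auto simp: mono_on_def)
    then show "?f a \<le> ?f b" using ab less[of a] by (cases "b = s"; cases "a = s") auto
  qed
  have le: "?f i \<le> N" if "i < m" for i using Suc.prems(4)[of i] that by auto
  have fs: "f s \<noteq> 0" using Suc.prems(5)[of s] by simp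
  have "e ^ s * part_shift e A m g 0 (\<lambda>i. if i < s then ?f i - 1 else ?f i) \<le> part_shift e A m g s ?f"
    by (rule Suc.IH[OF _ strict(1) mono le]) (use Suc.prems in auto)
  also have "(\<lambda>i. if i < s then ?f i - 1 else ?f i) = (\<lambda>i. if i < Suc s then f i - 1 else f i)"
    by (auto simp: fun_eq_iff less_Suc_eq)
  finally have "e * (e ^ s * part_shift e A m g 0 (\<lambda>i. if i < Suc s then f i - 1 else f i))
      \<le> e * part_shift e A m g s ?f" using e by (rule mult_left_mono)
  moreover have "0 \<le> part_shift e A m g s f"
    by (rule part_shift_nonneg[OF TN e g]) (use Suc.prems strict in auto)
  ultimately show ?case using Suc.prems(1) fs by (simp add: part_shift_Suc mult.assoc)
qed simp

lemma totally_nonneg_add_prev_row: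
  assumes "totally_nonneg (enat N) A" "e \<ge> 0"
  shows "totally_nonneg (enat N) (add_prev_row e A)"
  unfolding totally_nonneg_def
proof (intro allI impI, elim conjE)
  fix m and f g :: "nat \<Rightarrow> nat"
  assume fg: "strict_mono_on {..<m} f" "strict_mono_on {..<m} g"
    "\<forall>i<m. enat (f i) \<le> enat N \<and> enat (g i) \<le> enat N"
  have "0 \<le> part_shift e A m g m f"
    by (rule part_shift_nonneg[OF assms])
      (use fg in \<open>auto intro: strict_mono_on_imp_mono_on\<close>)
  also have "part_shift e A m g m f = det_of m (\<lambda>i j. add_prev_row e A (f i) (g j))"
    unfolding part_shift_def by (intro det_of_cong) auto
  finally show "0 \<le> det_of m (\<lambda>i j. add_prev_row e A (f i) (g j))" .
qed

definition unitriangular :: "nat \<Rightarrow> (nat \<Rightarrow> nat \<Rightarrow> real) \<Rightarrow> bool" where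
  "unitriangular N A \<longleftrightarrow> (\<forall>i\<le>N. A i i = 1) \<and> (\<forall>i j. i < j \<longrightarrow> j \<le> N \<longrightarrow> A i j = 0)"

lemma unitriangular_add_prev_row:
  "unitriangular N A \<Longrightarrow> unitriangular N (add_prev_row e A)"
  unfolding unitriangular_def add_prev_row_def by auto

text \<open>Each round carries positivity one starting row further down. Initially only the leading
  minors, equal to 1, are known to be positive. Minors already positive stay so by
  \<open>part_shift_ge\<close>; the one starting at row \<open>i + 1\<close> is bounded below by a
  power of \<open>e\<close> times the one starting at row \<open>i\<close>.\<close>

lemma initial_minors_pos:
  assumes TN: "totally_nonneg (enat N) A" and uni: "unitriangular N A" and e: "e > 0"
    and "n \<le> i" "n + k \<le> N"
  shows "0 < det_of (Suc k) (\<lambda>a b. (add_prev_row e ^^ i) A (n + a) b)"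
proof -
  have inv: "totally_nonneg (enat N) ((add_prev_row e ^^ i) A) \<and> unitriangular N ((add_prev_row e ^^ i) A)" for i
    using TN uni e by (induction i) (auto intro: totally_nonneg_add_prev_row unitriangular_add_prev_row)
  show ?thesis using assms(4,5)
  proof (induction i arbitrary: n)
    case 0
    then show ?case using uni unfolding unitriangular_def
      by (subst det_of_lower_triangular) auto
  next
    case (Suc i)
    let ?A = "(add_prev_row e ^^ i) A"
    have TN': "totally_nonneg (enat N) ?A" using inv by blast
    have g: "strict_mono_on {..<Suc k} (\<lambda>b::nat. b)" "\<And>b. b < Suc k \<Longrightarrow> b \<le> N"
      using Suc.prems by (auto simp: strict_mono_on_def)
    have f: "strict_mono_on {..<Suc k} (\<lambda>a. n + a)" "\<And>a. a < Suc k \<Longrightarrow> n + a \<le> N"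
      using Suc.prems by (auto simp: strict_mono_on_def)
    have eq0: "part_shift e ?A (Suc k) (\<lambda>b. b) 0 h = det_of (Suc k) (\<lambda>a b. ?A (h a) b)" for h
      unfolding part_shift_def by (intro det_of_cong) auto
    have eq: "part_shift e ?A (Suc k) (\<lambda>b. b) (Suc k) (\<lambda>a. n + a) =
        det_of (Suc k) (\<lambda>a b. (add_prev_row e ^^ Suc i) A (n + a) b)"
      unfolding part_shift_def by (intro det_of_cong) auto
    show ?case
    proof (cases "n \<le> i")
      case True
      have "0 < det_of (Suc k) (\<lambda>a b. ?A (n + a) b)" using Suc True by blast
      also have "\<dots> \<le> part_shift e ?A (Suc k) (\<lambda>b. b) (Suc k) (\<lambda>a. n + a)"
        unfolding eq0[symmetric] using e by (intro part_shift_ge[OF TN' _ g f]) auto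
      finally show ?thesis unfolding eq .
    next
      case False
      then have n: "n = Suc i" using Suc.prems by simp
      have "0 < det_of (Suc k) (\<lambda>a b. ?A (i + a) b)" using Suc.prems n by (intro Suc.IH) auto
      also have "\<dots> = part_shift e ?A (Suc k) (\<lambda>b. b) 0
          (\<lambda>a. if a < Suc k then n + a - 1 else n + a)"
        unfolding eq0 by (intro det_of_cong) (auto simp: n)
      finally have "0 < e ^ Suc k * part_shift e ?A (Suc k) (\<lambda>b. b) 0
          (\<lambda>a. if a < Suc k then n + a - 1 else n + a)" using e by simp
      also have "\<dots> \<le> part_shift e ?A (Suc k) (\<lambda>b. b) (Suc k) (\<lambda>a. n + a)"
        using e f n by (intro part_shift_ge_shifted[OF TN' _ g]) (auto intro: strict_mono_on_imp_mono_on)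
      finally show ?thesis unfolding eq .
    qed
  qed
qed

section \<open>Neville elimination\<close>

text \<open>
  Row \<open>n\<close> after \<open>k\<close> steps of Neville elimination. It is meaningful only for \<open>k \<le> n\<close>; under the
  positivity assumption of \<open>neville_pos\<close> no pivot vanishes there.
\<close>
fun neville :: "(nat \<Rightarrow> nat \<Rightarrow> real) \<Rightarrow> nat \<Rightarrow> nat \<Rightarrow> nat \<Rightarrow> real" where
  "neville A n 0 j = A n j"
| "neville A n (Suc k) j =
     neville A n k j - neville A n k k / neville A (n - 1) k k * neville A (n - 1) k j"

text \<open>Row \<open>a\<close> of the window undergoes only \<open>min a s\<close> steps, so the
  next step changes exactly the rows with \<open>a > s\<close>, each by a multiple of its
  predecessor.\<close>

lemma neville_det:
  "s \<le> k \<Longrightarrow> det_of (Suc k) (\<lambda>a b. neville A (n + a) (min a s) b) = det_of (Suc k) (\<lambda>a b. A (n + a) b)"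
proof (induction s)
  case 0
  then show ?case by (intro det_of_cong) auto
next
  case (Suc s)
  let ?r = "\<lambda>a b. neville A (n + a) (min a s) b"
  let ?c = "\<lambda>a. if a \<le> s then 0 else neville A (n + a) s s / neville A (n + a - 1) s s"
  have "det_of (Suc k) (\<lambda>a b. neville A (n + a) (min a (Suc s)) b) =
      det_of (Suc k) (\<lambda>a b. ?r a b - ?c a * ?r (a - 1) b)"
  proof (intro det_of_cong)
    fix a b
    show "neville A (n + a) (min a (Suc s)) b = ?r a b - ?c a * ?r (a - 1) b"
    proof (cases "a \<le> s")
      case False
      then have "min a (Suc s) = Suc s" "min a s = s" "min (a - 1) s = s" "n + (a - 1) = n + a - 1"
        by auto
      then show ?thesis using False by (simp only: neville.simps if_False)
    qed (auto simp: min_def)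
  qed
  also have "\<dots> = det_of (Suc k) ?r" by (rule det_of_diff_prev_row) simp
  finally show ?case using Suc by simp
qed

text \<open>Eliminating the window of rows \<open>n - k\<close> to \<open>n\<close> makes it upper
  triangular, so its positive minor is the product of the pivots. All pivots but the last are
  positive by induction, hence so is the last.\<close>

lemma neville_pos:
  assumes pos: "\<And>n k. n + k \<le> N \<Longrightarrow> 0 < det_of (Suc k) (\<lambda>a b. A (n + a) b)"
    and "k \<le> n" "n \<le> N"
  shows "0 < neville A n k k \<and> (\<forall>j<k. neville A n k j = 0)"
  using assms(2,3)
proof (induction k arbitrary: n rule: less_induct)
  case (less k)
  have zero: "neville A n' k' j = 0" if "k' \<le> k" "k' \<le> n'" "n' \<le> N" "j < k'" for n' k' j
  proof (cases k')
    case (Suc l)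
    then have "0 < neville A (n' - 1) l l" "\<forall>i<l. neville A (n' - 1) l i = 0" "\<forall>i<l. neville A n' l i = 0"
      using less.IH[of l "n' - 1"] less.IH[of l n'] that by auto
    then show ?thesis using that Suc by (cases "j = l") auto
  qed (use that in simp)
  define b where "b = n - k"
  have b: "b + k = n" using less.prems by (simp add: b_def)
  have "0 < det_of (Suc k) (\<lambda>a j. A (b + a) j)" using pos b less.prems by simp
  also have "\<dots> = det_of (Suc k) (\<lambda>a j. neville A (b + a) (min a k) j)"
    by (rule neville_det[symmetric]) simp
  also have "\<dots> = det_of (Suc k) (\<lambda>a j. neville A (b + a) a j)"
    by (intro det_of_cong) (simp add: min_def)
  also have "\<dots> = (\<Prod>a<Suc k. neville A (b + a) a a)"
    using less.prems b by (intro det_of_upper_triangular zero) auto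
  also have "\<dots> = (\<Prod>a<k. neville A (b + a) a a) * neville A n k k" by (simp add: b)
  finally have "0 < (\<Prod>a<k. neville A (b + a) a a) * neville A n k k" .
  moreover have "0 < (\<Prod>a<k. neville A (b + a) a a)"
    using less.IH less.prems b by (intro prod_pos) auto
  ultimately have "0 < neville A n k k" by (simp add: zero_less_mult_iff)
  then show ?case using zero[of k n] less.prems by auto
qed

text \<open>Only rows above row \<open>n\<close> are subtracted from it, and these vanish in column
  \<open>n\<close> throughout.\<close>

lemma neville_unitriangular:
  assumes "unitriangular N A" "n \<le> N"
  shows "k \<le> n \<Longrightarrow> neville A n k n = 1" and "k \<le> n' \<Longrightarrow> n' < n \<Longrightarrow> neville A n' k n = 0"
proof -
  have zero: "k \<le> n' \<Longrightarrow> n' < n \<Longrightarrow> neville A n' k n = 0" for n' k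
    using assms by (induction k arbitrary: n') (auto simp: unitriangular_def)
  then show "k \<le> n' \<Longrightarrow> n' < n \<Longrightarrow> neville A n' k n = 0" .
  show "k \<le> n \<Longrightarrow> neville A n k n = 1"
    using assms zero by (induction k) (auto simp: unitriangular_def)
qed

lemma tendsto_add_prev_row:
  assumes "e \<longlonglongrightarrow> 0"
  shows "(\<lambda>t. (add_prev_row (e t) ^^ i) A n j) \<longlonglongrightarrow> A n j"
proof (induction i arbitrary: n j)
  case (Suc i)
  have "(\<lambda>t. (add_prev_row (e t) ^^ i) A n j + e t * (if n = 0 then 0 else (add_prev_row (e t) ^^ i) A (n - 1) j))
      \<longlonglongrightarrow> A n j + 0 * (if n = 0 then 0 else A (n - 1) j)"
    using Suc by (intro tendsto_add tendsto_mult assms) auto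
  moreover have "(add_prev_row (e t) ^^ Suc i) A n j = (add_prev_row (e t) ^^ i) A n j
      + e t * (if n = 0 then 0 else (add_prev_row (e t) ^^ i) A (n - 1) j)" for t
    by (subst add_prev_row_def[symmetric]) simp
  ultimately show ?case by simp
qed simp

section \<open>Sectors\<close>

text \<open>
  In the next two identities, \<open>a\<close>, \<open>b\<close>, \<open>c\<close> are the sums over \<open>k < i\<close>, \<open>i \<le> k < j\<close> and \<open>j \<le> k\<close>
  in the recursion. The mixed terms in \<open>a\<close> and \<open>c\<close> of indefinite sign cancel or combine to a
  square.
\<close>
lemma Im_step_lower:
  fixes a b c z :: complex
  defines "w \<equiv> z * cnj (1 + z)"
  shows "Im ((z * a + z * b + (1 + z) * c) * cnj (z * a + (1 + z) * b + (1 + z) * c)) =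
    Im (w * a * cnj b) + (cmod z)\<^sup>2 * Im (b * cnj a) + (cmod b)\<^sup>2 * Im z
    + Im (w * b * cnj c) + (cmod (1 + z))\<^sup>2 * Im (c * cnj b)"
  unfolding w_def cmod_power2 by (simp add: power2_eq_square algebra_simps)

lemma Im_step_upper:
  fixes a b c z :: complex
  defines "w \<equiv> z * cnj (1 + z)"
  shows "Im (z * (z * a + (1 + z) * b + (1 + z) * c) * cnj ((1 + z) * (z * a + z * b + (1 + z) * c))) =
    Im z * (cmod (z * a + (1 + z) * c))\<^sup>2
    + (cmod z)\<^sup>2 * (Im (w * a * cnj b) + (cmod (1 + z))\<^sup>2 * Im (c * cnj b))
    + (cmod (1 + z))\<^sup>2 * ((cmod z)\<^sup>2 * Im (b * cnj a) + Im (w * b * cnj c))"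
  unfolding w_def cmod_power2 by (simp add: power2_eq_square algebra_simps)

lemma Im_of_real_mult: "Im (of_real x * y) = x * Im y"
  by simp

lemma Im_sum_mult_cnj_sum_nonneg:
  fixes f g :: "nat \<Rightarrow> complex" and l m :: "nat \<Rightarrow> real"
  assumes "\<And>i j. i \<in> I \<Longrightarrow> j \<in> J \<Longrightarrow> 0 \<le> Im (w * f i * cnj (g j))"
    and "\<And>i. i \<in> I \<Longrightarrow> 0 \<le> l i" "\<And>j. j \<in> J \<Longrightarrow> 0 \<le> m j"
  shows "0 \<le> Im (w * (\<Sum>i\<in>I. of_real (l i) * f i) * cnj (\<Sum>j\<in>J. of_real (m j) * g j))"
proof -
  have "w * (\<Sum>i\<in>I. of_real (l i) * f i) * cnj (\<Sum>j\<in>J. of_real (m j) * g j)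
      = (\<Sum>i\<in>I. \<Sum>j\<in>J. of_real (l i * m j) * (w * f i * cnj (g j)))"
    by (simp add: sum_distrib_left sum_distrib_right mult_ac)
  then have "Im (w * (\<Sum>i\<in>I. of_real (l i) * f i) * cnj (\<Sum>j\<in>J. of_real (m j) * g j))
      = (\<Sum>i\<in>I. \<Sum>j\<in>J. l i * m j * Im (w * f i * cnj (g j)))"
    by (simp only: Im_sum Im_of_real_mult)
  also have "\<dots> \<ge> 0" using assms by (intro sum_nonneg mult_nonneg_nonneg) auto
  finally show ?thesis .
qed

text \<open>
  As \<open>j\<close> grows, the argument of \<open>f j\<close> increases, by at most that of \<open>z / (1 + z)\<close> in total. For
  polynomials \<open>f i\<close>, \<open>f j\<close> and all \<open>z\<close> in the upper half plane this encodes \<open>f i \<prec> f j\<close> together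
  with zeros in \<open>[-1, 0]\<close>.
\<close>
definition sector_chain :: "complex \<Rightarrow> nat \<Rightarrow> (nat \<Rightarrow> complex) \<Rightarrow> bool" where
  "sector_chain z n f \<longleftrightarrow> (\<forall>j\<le>n. f j \<noteq> 0) \<and>
     (\<forall>i j. i \<le> j \<longrightarrow> j \<le> n \<longrightarrow>
        0 \<le> Im (f j * cnj (f i)) \<and> 0 \<le> Im (z * cnj (1 + z) * f i * cnj (f j)))"

lemma Im_mult_cnj_one_plus: "Im (z * cnj (1 + z)) = Im z"
  by (simp add: algebra_simps)

text \<open>If the sum vanished, the later terms would add up to the negative of the first. Pairing
  the first term with them would then give a negative multiple of \<open>Im z\<close>, although all
  pairings are nonnegative.\<close>

lemma sector_chain_sum_nonzero:
  assumes ch: "sector_chain z n f" and z: "0 < Im z" and l: "\<And>k. k \<le> n \<Longrightarrow> 0 < l k"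
    and ij: "i < j" "j \<le> Suc n"
  shows "(\<Sum>k\<in>{i..<j}. of_real (l k) * f k) \<noteq> (0::complex)"
proof
  let ?w = "z * cnj (1 + z)"
  assume sum0: "(\<Sum>k\<in>{i..<j}. of_real (l k) * f k) = 0"
  have split: "(\<Sum>k\<in>{i..<j}. of_real (l k) * f k)
      = of_real (l i) * f i + (\<Sum>k\<in>{Suc i..<j}. of_real (l k) * f k)"
    using ij by (simp add: sum.atLeast_Suc_lessThan)
  have nz: "f i \<noteq> 0" using ch ij unfolding sector_chain_def by auto
  have "0 \<le> Im (?w * (\<Sum>k\<in>{i}. of_real (l k) * f k) * cnj (\<Sum>k\<in>{Suc i..<j}. of_real (l k) * f k))"
    using ch ij l unfolding sector_chain_def
    by (intro Im_sum_mult_cnj_sum_nonneg) (auto intro: less_imp_le)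
  also have "(\<Sum>k\<in>{Suc i..<j}. of_real (l k) * f k) = - (of_real (l i) * f i)"
    using sum0 split by (simp add: eq_neg_iff_add_eq_0 add.commute)
  also have "Im (?w * (\<Sum>k\<in>{i}. of_real (l k) * f k) * cnj (- (of_real (l i) * f i)))
      = - ((l i)\<^sup>2 * (cmod (f i))\<^sup>2 * Im ?w)"
    unfolding cmod_power2 by (simp add: power2_eq_square algebra_simps)
  also have "\<dots> < 0" using nz z l[of i] ij unfolding Im_mult_cnj_one_plus by simp
  finally show False by simp
qed

text \<open>With the sums split into blocks at \<open>i\<close> and \<open>j\<close>, the identities
  \<open>Im_step_lower\<close> and \<open>Im_step_upper\<close> express both inequalities through
  nonnegative pairings of blocks. A zero of \<open>g j\<close> would force both of its blocks to
  vanish.\<close>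

lemma sector_chain_step:
  fixes f g :: "nat \<Rightarrow> complex" and l :: "nat \<Rightarrow> real"
  assumes ch: "sector_chain z n f" and z: "0 < Im z" and l: "\<And>k. k \<le> n \<Longrightarrow> 0 < l k"
    and g: "\<And>j. j \<le> Suc n \<Longrightarrow> g j = z * (\<Sum>k<j. of_real (l k) * f k)
        + (1 + z) * (\<Sum>k\<in>{j..<Suc n}. of_real (l k) * f k)"
  shows "sector_chain z (Suc n) g"
proof -
  let ?w = "z * cnj (1 + z)"
  let ?S = "\<lambda>i j. \<Sum>k\<in>{i..<j}. of_real (l k) * f k"
  have up: "0 \<le> Im (?w * ?S i j * cnj (?S j' k))" if "j \<le> j'" "j' \<le> Suc n" "k \<le> Suc n" for i j j' k
    using ch l that unfolding sector_chain_def
    by (intro Im_sum_mult_cnj_sum_nonneg) (auto intro: less_imp_le)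
  have low: "0 \<le> Im (?S j' k * cnj (?S i j))" if "j \<le> j'" "j' \<le> Suc n" "k \<le> Suc n" for i j j' k
  proof -
    have "0 \<le> Im (1 * ?S j' k * cnj (?S i j))"
    proof (rule Im_sum_mult_cnj_sum_nonneg)
      fix a b assume "a \<in> {j'..<k}" "b \<in> {i..<j}"
      then have "b \<le> a" "a \<le> n" using that by auto
      then show "0 \<le> Im (1 * f a * cnj (f b))" using ch unfolding sector_chain_def mult_1 by blast
    qed (use l that in \<open>auto intro: less_imp_le\<close>)
    then show ?thesis by (simp only: mult_1)
  qed
  have split: "?S i k = ?S i j + ?S j k" if "i \<le> j" "j \<le> k" for i j k
    using that by (simp add: sum.atLeastLessThan_concat)
  have g': "g j = z * ?S 0 j + (1 + z) * ?S j (Suc n)" if "j \<le> Suc n" for j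
    using g[OF that] by (simp add: atLeast0LessThan)
  have "g j \<noteq> 0" if j: "j \<le> Suc n" for j
  proof
    define a c where "a = ?S 0 j" and "c = ?S j (Suc n)"
    assume "g j = 0"
    then have eq: "z * a = - ((1 + z) * c)"
      using g'[OF j] unfolding a_def c_def by (simp add: eq_neg_iff_add_eq_0)
    have "(cmod a)\<^sup>2 * Im z = Im (?w * a * cnj a)"
      unfolding cmod_power2 by (simp add: power2_eq_square algebra_simps)
    also have "?w * a * cnj a = (z * a) * cnj (1 + z) * cnj a" by (simp add: mult_ac)
    also have "\<dots> = - of_real ((cmod (1 + z))\<^sup>2) * (c * cnj a)"
      unfolding eq complex_norm_square by (simp add: mult_ac)
    also have "Im \<dots> = - ((cmod (1 + z))\<^sup>2 * Im (c * cnj a))"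
      by (simp only: Im_of_real_mult mult_minus_left uminus_complex.sel)
    also have "\<dots> \<le> 0" using low[where i = 0 and j = j and j' = j and k = "Suc n"] j unfolding a_def c_def by simp
    finally have a0: "a = 0" using z by (simp add: mult_le_0_iff)
    have "1 + z \<noteq> 0" using z by (auto simp: complex_eq_iff)
    then have c0: "c = 0" using eq a0 by simp
    show False
    \<comment> \<open>At least one of the two blocks is nonempty, so its sum cannot vanish.\<close>
    proof (cases "j = 0")
      case True
      then show False using sector_chain_sum_nonzero[where i = 0 and j = "Suc n" and l = l, OF ch z l] c0 unfolding c_def by auto
    next
      case False
      then show False using sector_chain_sum_nonzero[where i = 0 and j = j and l = l, OF ch z l] a0 j unfolding a_def by auto
    qed
  qed
  moreover have "0 \<le> Im (g j * cnj (g i)) \<and> 0 \<le> Im (z * cnj (1 + z) * g i * cnj (g j))"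
    if ij: "i \<le> j" "j \<le> Suc n" for i j
  proof -
    define a b c where "a = ?S 0 i" and "b = ?S i j" and "c = ?S j (Suc n)"
    have ga: "g i = z * a + (1 + z) * b + (1 + z) * c" "g j = z * a + z * b + (1 + z) * c"
      using g' ij split[of i j "Suc n"] split[of 0 i j]
      unfolding a_def b_def c_def by (simp_all add: algebra_simps)
    have nn: "0 \<le> Im (?w * a * cnj b)" "0 \<le> Im (b * cnj a)" "0 \<le> Im (?w * b * cnj c)" "0 \<le> Im (c * cnj b)"
      unfolding a_def b_def c_def using ij by (intro up low; simp)+
    have "0 \<le> Im (g j * cnj (g i))"
      unfolding ga Im_step_lower using nn z by (intro add_nonneg_nonneg mult_nonneg_nonneg) auto
    moreover have "0 \<le> Im (z * g i * cnj ((1 + z) * g j))"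
      unfolding ga Im_step_upper using nn z by (intro add_nonneg_nonneg mult_nonneg_nonneg) auto
    moreover have "z * cnj (1 + z) * g i * cnj (g j) = z * g i * cnj ((1 + z) * g j)"
      by (simp add: mult_ac)
    ultimately show ?thesis by metis
  qed
  ultimately show ?thesis unfolding sector_chain_def by blast
qed

lemma telescoped_recursion:
  fixes q :: "nat \<Rightarrow> nat \<Rightarrow> 'a::real_field" and l :: "nat \<Rightarrow> nat \<Rightarrow> real"
  assumes rec: "\<And>k. k < n \<Longrightarrow> q n k = q n (Suc k) + of_real (l n k) * q (n - 1) k"
    and diag: "z * q n 0 = (1 + z) * q n n" and "j \<le> n"
  shows "q n j = z * (\<Sum>k<j. of_real (l n k) * q (n - 1) k)
      + (1 + z) * (\<Sum>k\<in>{j..<n}. of_real (l n k) * q (n - 1) k)"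
proof -
  let ?S = "\<lambda>i j. \<Sum>k\<in>{i..<j}. of_real (l n k) * q (n - 1) k"
  have tele: "q n j = q n n + ?S j n" if "j \<le> n" for j
    using that
  proof (induction "n - j" arbitrary: j)
    case (Suc d)
    then have "q n (Suc j) = q n n + ?S (Suc j) n" "j < n" by auto
    then show ?case using rec[of j] by (simp add: sum.atLeast_Suc_lessThan algebra_simps)
  qed simp
  \<comment> \<open>Inserting \<open>q n 0 = q n n + ?S 0 n\<close> into the diagonal condition
    cancels \<open>z * q n n\<close>.\<close>
  have "q n n = z * ?S 0 n" using diag tele[of 0] by (simp add: algebra_simps)
  moreover have "?S 0 n = ?S 0 j + ?S j n" using \<open>j \<le> n\<close> by (simp add: sum.atLeastLessThan_concat)
  ultimately show ?thesis using tele[OF \<open>j \<le> n\<close>] by (simp add: atLeast0LessThan algebra_simps)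
qed

section \<open>Chain values along the Neville elimination\<close>

context
  fixes A :: "nat \<Rightarrow> nat \<Rightarrow> real" and N :: nat
  assumes uni: "unitriangular N A"
    and pos: "\<And>n k. n + k \<le> N \<Longrightarrow> 0 < det_of (Suc k) (\<lambda>a b. A (n + a) b)"
begin

definition nev_coeff :: "nat \<Rightarrow> nat \<Rightarrow> real" where
  "nev_coeff n k = neville A n k k / neville A (n - 1) k k"

text \<open>The numbers \<open>q_{n,k}\<close>. The type is any \<open>real_field\<close>, so that
  evaluation at complex and at real points share the recursion.\<close>

definition nev_comb :: "(nat \<Rightarrow> 'a::real_field) \<Rightarrow> nat \<Rightarrow> nat \<Rightarrow> 'a" where
  "nev_comb p n k = (\<Sum>j\<le>n. of_real (neville A n k j) * p j)"

lemma nev_coeff_pos: "k < n \<Longrightarrow> n \<le> N \<Longrightarrow> 0 < nev_coeff n k"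
  unfolding nev_coeff_def
  using neville_pos[of N A k n] neville_pos[of N A k "n - 1"] pos by (intro divide_pos_pos) auto

text \<open>After \<open>n\<close> elimination steps row \<open>n\<close> is a unit vector.\<close>

lemma nev_comb_diag: "n \<le> N \<Longrightarrow> nev_comb p n n = p n"
proof -
  assume n: "n \<le> N"
  have "nev_comb p n n = (\<Sum>j\<le>n. if j = n then p n else 0)"
    unfolding nev_comb_def
    using neville_pos[of N A n n] pos n neville_unitriangular(1)[OF uni n, of n] by (intro sum.cong) auto
  then show ?thesis by simp
qed

lemma nev_comb_rec:
  assumes "k < n" "n \<le> N"
  shows "nev_comb p n k = nev_comb p n (Suc k) + of_real (nev_coeff n k) * nev_comb p (n - 1) k"
proof -
  \<comment> \<open>This lets the sum for row \<open>n - 1\<close> be extended to the index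
    \<open>n\<close>.\<close>
  have "neville A (n - 1) k n = 0"
    using assms by (intro neville_unitriangular(2)[OF uni]) auto
  moreover obtain m where "n = Suc m" using assms by (cases n) auto
  ultimately have "nev_comb p (n - 1) k = (\<Sum>j\<le>n. of_real (neville A (n - 1) k j) * p j)"
    unfolding nev_comb_def by simp
  moreover have "neville A n k j = neville A n (Suc k) j + nev_coeff n k * neville A (n - 1) k j" for j
    by (simp add: nev_coeff_def)
  ultimately show ?thesis unfolding nev_comb_def[of p n]
    by (simp add: sum_distrib_left sum.distrib[symmetric] algebra_simps del: neville.simps)
qed

lemma nev_comb_formula:
  fixes p :: "nat \<Rightarrow> 'a::real_field"
  assumes "0 < n" "n \<le> N" and p_rec: "p n = z * (\<Sum>k<n. of_real (A n k) * p k)" and "j \<le> n"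
  shows "nev_comb p n j = z * (\<Sum>k<j. of_real (nev_coeff n k) * nev_comb p (n - 1) k)
      + (1 + z) * (\<Sum>k\<in>{j..<n}. of_real (nev_coeff n k) * nev_comb p (n - 1) k)"
proof (rule telescoped_recursion)
  have "nev_comb p n 0 = (\<Sum>k<n. of_real (A n k) * p k) + p n"
    using uni assms(2) unfolding nev_comb_def unitriangular_def
    by (simp add: lessThan_Suc_atMost[symmetric])
  then show "z * nev_comb p n 0 = (1 + z) * nev_comb p n n"
    using p_rec nev_comb_diag[OF assms(2), of p] by (simp add: algebra_simps)
qed (use assms nev_comb_rec in auto)

context
  fixes p :: "nat \<Rightarrow> complex" and z :: complex
  assumes p0: "p 0 = 1"
    and p_rec: "\<And>n. 0 < n \<Longrightarrow> n \<le> N \<Longrightarrow> p n = z * (\<Sum>k<n. of_real (A n k) * p k)"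
    and z: "0 < Im z"
begin

lemma sector_chain_nev_comb: "n \<le> N \<Longrightarrow> sector_chain z n (nev_comb p n)"
proof (induction n)
  case 0
  have "nev_comb p 0 0 = 1" using nev_comb_diag[of 0 p] p0 by simp
  then show ?case using z unfolding sector_chain_def by (simp add: algebra_simps)
next
  case (Suc n)
  have "sector_chain z n (nev_comb p n)" using Suc by simp
  then show ?case
  proof (rule sector_chain_step[OF _ z])
    show "0 < nev_coeff (Suc n) k" if "k \<le> n" for k using nev_coeff_pos Suc.prems that by simp
    show "nev_comb p (Suc n) j = z * (\<Sum>k<j. of_real (nev_coeff (Suc n) k) * nev_comb p n k)
        + (1 + z) * (\<Sum>k\<in>{j..<Suc n}. of_real (nev_coeff (Suc n) k) * nev_comb p n k)"
      if "j \<le> Suc n" for j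
      using nev_comb_formula[OF _ Suc.prems p_rec[OF _ Suc.prems], of j] that by simp
  qed
qed

lemma rec_nonzero_upper: "n \<le> N \<Longrightarrow> p n \<noteq> 0"
  using sector_chain_nev_comb[of n] nev_comb_diag[of n p] unfolding sector_chain_def by auto

text \<open>\<open>p (Suc n)\<close> is \<open>z\<close> times a positive combination of the
  \<open>nev_comb p n k\<close>. Writing \<open>z\<close> as \<open>z * cnj (1 + z)\<close> minus
  the square of \<open>cmod z\<close> reduces each pairing with \<open>p n\<close> to the two
  inequalities of \<open>sector_chain\<close>.\<close>

lemma rec_Im_nonneg:
  assumes "Suc n \<le> N"
  shows "0 \<le> Im (p (Suc n) * cnj (p n))"
proof -
  have ch: "sector_chain z n (nev_comb p n)" using sector_chain_nev_comb assms by simp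
  have nn: "0 \<le> Im (z * nev_comb p n k * cnj (p n))" if "k \<le> n" for k
  proof -
    let ?f = "nev_comb p n k" and ?g = "p n"
    have "0 \<le> Im (?g * cnj ?f)" "0 \<le> Im (z * cnj (1 + z) * ?f * cnj ?g)"
      using ch that nev_comb_diag[of n p] assms unfolding sector_chain_def by (metis Suc_leD le_refl)+
    moreover have "Im (z * ?f * cnj ?g) = Im (z * cnj (1 + z) * ?f * cnj ?g) + (cmod z)\<^sup>2 * Im (?g * cnj ?f)"
      unfolding cmod_power2 by (simp add: power2_eq_square algebra_simps)
    ultimately show ?thesis by (simp only: add_nonneg_nonneg mult_nonneg_nonneg zero_le_power2)
  qed
  have "p (Suc n) = z * (\<Sum>k<Suc n. of_real (nev_coeff (Suc n) k) * nev_comb p n k)"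
    using nev_comb_formula[OF _ assms p_rec[OF _ assms], of "Suc n"] nev_comb_diag[of "Suc n" p] assms by simp
  then have "p (Suc n) * cnj (p n) =
      z * (\<Sum>k<Suc n. of_real (nev_coeff (Suc n) k) * nev_comb p n k) * cnj (\<Sum>k\<in>{n}. of_real 1 * p k)"
    by simp
  also have "0 \<le> Im \<dots>"
  proof (rule Im_sum_mult_cnj_sum_nonneg)
    show "0 \<le> nev_coeff (Suc n) k" if "k \<in> {..<Suc n}" for k
      using nev_coeff_pos[of k "Suc n"] that assms by simp
  qed (use nn in auto)
  finally show ?thesis .
qed

end

text \<open>Outside \<open>[-1, 0]\<close> the numbers \<open>x\<close> and \<open>1 + x\<close>
  share the sign \<open>s\<close>, so each step multiplies the common sign of all
  \<open>nev_comb p n j\<close> by \<open>s\<close>.\<close>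

lemma rec_nonzero_real:
  fixes p :: "nat \<Rightarrow> real" and x :: real
  assumes p0: "p 0 = 1"
    and p_rec: "\<And>n. 0 < n \<Longrightarrow> n \<le> N \<Longrightarrow> p n = x * (\<Sum>k<n. A n k * p k)"
    and x: "x < -1 \<or> 0 < x" and "n \<le> N"
  shows "p n \<noteq> 0"
proof -
  define s :: real where "s = sgn x"
  have s: "0 < s * x" "0 < s * (1 + x)" using x by (auto simp: s_def sgn_if)
  have "\<forall>j\<le>n. 0 < s ^ n * nev_comb p n j" using \<open>n \<le> N\<close>
  proof (induction n)
    case 0
    then show ?case using nev_comb_diag[of 0 p] p0 by simp
  next
    case (Suc n)
    show ?case
    proof (intro allI impI)
      fix j assume j: "j \<le> Suc n"
      let ?t = "\<lambda>k. nev_coeff (Suc n) k * (s ^ n * nev_comb p n k)"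
      have t: "0 < ?t k" if "k < Suc n" for k
        using Suc that nev_coeff_pos[of k "Suc n"] by simp
      define X Y where "X = (\<Sum>k<j. nev_coeff (Suc n) k * nev_comb p n k)"
        and "Y = (\<Sum>k\<in>{j..<Suc n}. nev_coeff (Suc n) k * nev_comb p n k)"
      have XY: "s ^ n * X = (\<Sum>k<j. ?t k)" "s ^ n * Y = (\<Sum>k\<in>{j..<Suc n}. ?t k)"
        unfolding X_def Y_def sum_distrib_left by (simp_all only: mult_ac)
      have "nev_comb p (Suc n) j = x * X + (1 + x) * Y"
        using nev_comb_formula[of "Suc n" p x j] p_rec[of "Suc n"] Suc.prems j
        unfolding X_def Y_def by simp
      then have eq: "s ^ Suc n * nev_comb p (Suc n) j = s * x * (s ^ n * X) + s * (1 + x) * (s ^ n * Y)"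
        by (simp add: algebra_simps)
      have nn: "0 \<le> s ^ n * X" "0 \<le> s ^ n * Y"
        unfolding XY using j by (intro sum_nonneg less_imp_le[OF t], force)+
      have "0 < s ^ n * X \<or> 0 < s ^ n * Y"
        unfolding XY
      proof (cases "j = 0")
        case True
        then show "0 < (\<Sum>k<j. ?t k) \<or> 0 < (\<Sum>k\<in>{j..<Suc n}. ?t k)"
          by (intro disjI2 sum_pos t) auto
      next
        case False
        then show "0 < (\<Sum>k<j. ?t k) \<or> 0 < (\<Sum>k\<in>{j..<Suc n}. ?t k)"
          using j by (intro disjI1 sum_pos t) auto
      qed
      then show "0 < s ^ Suc n * nev_comb p (Suc n) j"
        unfolding eq using nn s by (auto intro: add_pos_nonneg add_nonneg_pos mult_pos_pos mult_nonneg_nonneg)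
    qed
  qed
  then have "0 < s ^ n * p n" using nev_comb_diag[OF \<open>n \<le> N\<close>, of p] by auto
  then show ?thesis by auto
qed

end

section \<open>Chain polynomials of a totally nonnegative matrix\<close>

lemma poly_of_real_add:
  "poly (map_poly complex_of_real (p + q)) z
    = poly (map_poly complex_of_real p) z + poly (map_poly complex_of_real q) z"
  by (simp add: of_real_hom.map_poly_hom_add)

lemma poly_of_real_sum:
  "poly (map_poly complex_of_real (\<Sum>i\<in>I. p i)) z = (\<Sum>i\<in>I. poly (map_poly complex_of_real (p i)) z)"
  by (induction I rule: infinite_finite_induct) (simp_all add: poly_of_real_add)

lemma poly_of_real_pCons:
  "poly (map_poly complex_of_real (pCons a p)) z = of_real a + z * poly (map_poly complex_of_real p) z"
  by (simp add: of_real_hom.map_poly_pCons_hom)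

lemma poly_of_real_cnj:
  "poly (map_poly complex_of_real p) (cnj z) = cnj (poly (map_poly complex_of_real p) z)"
  by (induction p) (simp_all add: poly_of_real_pCons)

text \<open>The recursion of the chain polynomials in terms of a matrix alone, so that it also
  applies to perturbed matrices that come from no poset.\<close>

fun chain_seq :: "(nat \<Rightarrow> nat \<Rightarrow> real) \<Rightarrow> nat \<Rightarrow> real poly" where
  "chain_seq A 0 = 1"
| "chain_seq A (Suc n) = pCons 0 (\<Sum>k\<le>n. Polynomial.smult (A (Suc n) k) (chain_seq A k))"

lemma poly_of_real_chain_seq:
  assumes "0 < n"
  shows "poly (map_poly complex_of_real (chain_seq A n)) z =
    z * (\<Sum>k<n. of_real (A n k) * poly (map_poly complex_of_real (chain_seq A k)) z)"
  using assms by (cases n)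
    (simp_all add: poly_of_real_pCons poly_of_real_sum poly_of_real_smult lessThan_Suc_atMost)

lemma poly_chain_seq:
  assumes "0 < n"
  shows "poly (chain_seq A n) x = x * (\<Sum>k<n. A n k * poly (chain_seq A k) x)"
  using assms by (cases n) (simp_all add: poly_sum lessThan_Suc_atMost)

lemma degree_chain_seq_le: "degree (chain_seq A n) \<le> n"
proof (induction n rule: less_induct)
  case (less n)
  show ?case
  proof (cases n)
    case (Suc m)
    have "degree (chain_seq A k) \<le> m" if "k \<le> m" for k
      using less[of k] Suc that by simp
    then have "degree (\<Sum>k\<le>m. Polynomial.smult (A n k) (chain_seq A k)) \<le> m"
      by (intro degree_sum_le order.trans[OF degree_smult_le]) auto
    then show ?thesis using Suc by (auto intro: order.trans[OF degree_pCons_le])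
  qed simp
qed

text \<open>Only the last summand of the recursion reaches the top degree.\<close>

lemma coeff_chain_seq: "coeff (chain_seq A n) n = (\<Prod>k<n. A (Suc k) k)"
proof (induction n)
  case (Suc n)
  have "coeff (chain_seq A (Suc n)) (Suc n) = (\<Sum>k\<le>n. A (Suc n) k * coeff (chain_seq A k) n)"
    by (simp add: coeff_sum)
  also have "\<dots> = (\<Sum>k\<in>{n}. A (Suc n) k * coeff (chain_seq A k) n)"
  proof (rule sum.mono_neutral_right)
    have "coeff (chain_seq A k) n = 0" if "k < n" for k
      using degree_chain_seq_le[of A k] that by (intro coeff_eq_0) simp
    then show "\<forall>k\<in>{..n} - {n}. A (Suc n) k * coeff (chain_seq A k) n = 0" by simp
  qed auto
  finally show ?case using Suc by simp
qed simp

lemma chain_seq_lead: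
  assumes "\<And>k. k < n \<Longrightarrow> 0 < A (Suc k) k"
  shows "degree (chain_seq A n) = n" and "0 < lead_coeff (chain_seq A n)"
proof -
  have pos: "0 < coeff (chain_seq A n) n" unfolding coeff_chain_seq using assms by (intro prod_pos) auto
  then have "n \<le> degree (chain_seq A n)" by (intro le_degree) simp
  then show "degree (chain_seq A n) = n" using degree_chain_seq_le[of A n] by simp
  then show "0 < lead_coeff (chain_seq A n)" using pos by simp
qed

lemma tendsto_poly_chain_seq:
  assumes "\<And>n k. (\<lambda>t. B t n k) \<longlonglongrightarrow> A n k"
  shows "(\<lambda>t. poly (map_poly complex_of_real (chain_seq (B t) n)) z)
    \<longlonglongrightarrow> poly (map_poly complex_of_real (chain_seq A n)) z"
proof (induction n rule: less_induct)
  case (less n)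
  show ?case
  proof (cases "n = 0")
    case False
    then have "0 < n" by simp
    show ?thesis unfolding poly_of_real_chain_seq[OF \<open>0 < n\<close>]
      using less by (intro tendsto_mult tendsto_sum tendsto_of_real assms tendsto_const) auto
  qed simp
qed

definition zeros_in_interval :: "real poly \<Rightarrow> bool" where
  "zeros_in_interval p \<longleftrightarrow> (\<forall>z. poly (map_poly complex_of_real p) z = 0 \<longrightarrow>
     (\<exists>r. z = complex_of_real r \<and> -1 \<le> r \<and> r \<le> 0))"

lemma real_rooted_if_zeros_in_interval: "zeros_in_interval p \<Longrightarrow> real_rooted p"
  unfolding zeros_in_interval_def real_rooted_def by force

text \<open>Each linear factor has modulus at least \<open>d\<close>. The bound involves only degree
  and leading coefficient, so it passes to limits.\<close>

lemma norm_poly_ge: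
  fixes p :: "real poly"
  assumes "zeros_in_interval p" and "0 \<le> d" and d: "\<And>r. -1 \<le> r \<Longrightarrow> r \<le> 0 \<Longrightarrow> d \<le> cmod (z - of_real r)"
  shows "\<bar>lead_coeff p\<bar> * d ^ degree p \<le> cmod (poly (map_poly complex_of_real p) z)"
proof (cases "p = 0")
  case False
  note rr = real_rooted_if_zeros_in_interval[OF assms(1)]
  note dec = real_rooted_decompose[OF rr False]
  have *: "d ^ size M \<le> cmod (poly (map_poly complex_of_real (\<Prod>a\<in>#M. [:- a, 1:])) z)"
    if "\<And>a. a \<in># M \<Longrightarrow> -1 \<le> a \<and> a \<le> 0" for M
    using that
  proof (induction M)
    case (add a M)
    have "d * d ^ size M \<le> cmod (z - of_real a) * cmod (poly (map_poly complex_of_real (\<Prod>a\<in>#M. [:- a, 1:])) z)"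
      using add d \<open>0 \<le> d\<close> by (intro mult_mono) auto
    also have "\<dots> = cmod (poly (map_poly complex_of_real (\<Prod>a\<in>#add_mset a M. [:- a, 1:])) z)"
      by (simp only: image_mset_add_mset prod_mset.add_mset poly_of_real_mult norm_mult) simp
    finally show ?case by simp
  qed simp
  have "-1 \<le> a \<and> a \<le> 0" if "a \<in># proots p" for a
  proof -
    have "poly (map_poly complex_of_real p) (of_real a) = 0" using that False by simp
    then obtain r where "complex_of_real a = of_real r" "-1 \<le> r" "r \<le> 0"
      using assms(1) unfolding zeros_in_interval_def by blast
    then show ?thesis by simp
  qed
  then have "d ^ size (proots p) \<le> cmod (poly (map_poly complex_of_real (\<Prod>a\<in>#proots p. [:- a, 1:])) z)"
    by (intro *)
  then show ?thesis unfolding dec(1) poly_of_real_real_rooted[OF rr False]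
    by (auto simp: norm_mult intro: mult_left_mono)
qed simp

lemma zeros_in_interval_chain_seq_pos:
  assumes uni: "unitriangular N A"
    and pos: "\<And>n k. n + k \<le> N \<Longrightarrow> 0 < det_of (Suc k) (\<lambda>a b. A (n + a) b)"
    and "n \<le> N"
  shows "zeros_in_interval (chain_seq A n)"
  unfolding zeros_in_interval_def
proof (intro allI impI)
  fix z assume z: "poly (map_poly complex_of_real (chain_seq A n)) z = 0"
  have upper: "poly (map_poly complex_of_real (chain_seq A n)) w \<noteq> 0" if "0 < Im w" for w
    by (rule rec_nonzero_upper[OF uni pos _ poly_of_real_chain_seq that \<open>n \<le> N\<close>]) auto
  have "Im z = 0" using upper[of z] upper[of "cnj z"] z
    by (cases "Im z" "0 :: real" rule: linorder_cases) (auto simp: poly_of_real_cnj)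
  then have zr: "z = of_real (Re z)" by (simp add: complex_eq_iff)
  then have "poly (map_poly complex_of_real (chain_seq A n)) (of_real (Re z)) = 0" using z by simp
  then have x: "poly (chain_seq A n) (Re z) = 0" by simp
  have "-1 \<le> Re z \<and> Re z \<le> 0"
  proof (rule ccontr)
    assume "\<not> ?thesis"
    then have "Re z < -1 \<or> 0 < Re z" by auto
    from rec_nonzero_real[OF uni pos _ poly_chain_seq this \<open>n \<le> N\<close>] x show False by auto
  qed
  then show "\<exists>r. z = complex_of_real r \<and> -1 \<le> r \<and> r \<le> 0" using zr by blast
qed

lemma chain_seq_totally_nonneg:
  assumes TN: "totally_nonneg (enat N) A" and uni: "unitriangular N A"
    and sub: "\<And>k. k < N \<Longrightarrow> 0 < A (Suc k) k"
  shows "n \<le> N \<Longrightarrow> zeros_in_interval (chain_seq A n)"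
    and "Suc n \<le> N \<Longrightarrow> 0 < Im z \<Longrightarrow>
      0 \<le> Im (poly (map_poly complex_of_real (chain_seq A (Suc n))) z
        * cnj (poly (map_poly complex_of_real (chain_seq A n)) z))"
proof -
  \<comment> \<open>\<open>N\<close> rounds make all initial minors positive, as every starting row
    is at most \<open>N\<close>.\<close>
  define B where "B t = (add_prev_row (inverse (real (Suc t))) ^^ N) A" for t
  have lim: "(\<lambda>t. B t n k) \<longlonglongrightarrow> A n k" for n k
    unfolding B_def by (intro tendsto_add_prev_row LIMSEQ_inverse_real_of_nat)
  note plim = tendsto_poly_chain_seq[of B A, OF lim]
  have uniB: "unitriangular N (B t)" for t
  proof -
    have "unitriangular N ((add_prev_row e ^^ i) A)" for e i
      using uni by (induction i) (auto intro: unitriangular_add_prev_row)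
    then show ?thesis unfolding B_def .
  qed
  have posB: "0 < det_of (Suc k) (\<lambda>a b. B t (n + a) b)" if "n + k \<le> N" for n k t
    unfolding B_def using that by (intro initial_minors_pos[OF TN uni]) auto
  show "zeros_in_interval (chain_seq A n)" if n: "n \<le> N"
    unfolding zeros_in_interval_def
  proof (intro allI impI, rule ccontr)
    fix z assume z: "poly (map_poly complex_of_real (chain_seq A n)) z = 0"
      and "\<not> (\<exists>r. z = complex_of_real r \<and> -1 \<le> r \<and> r \<le> 0)"
    then have "z \<notin> of_real ` {-1..0}" by auto
    moreover have "closed (complex_of_real ` {-1..0})"
      by (intro compact_imp_closed compact_continuous_image continuous_intros) auto
    ultimately obtain d where d: "0 < d" "\<And>w. w \<in> of_real ` {-1..0} \<Longrightarrow> d \<le> dist z w"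
      using separate_point_closed by metis
    \<comment> \<open>The coefficient of degree \<open>n\<close> by \<open>coeff_chain_seq\<close>.
      Its limit is positive because the subdiagonal of \<open>A\<close> is, so the lower bound on
      the modulus does not degenerate.\<close>
    let ?c = "\<lambda>C. \<Prod>k<n. C (Suc k) k :: real"
    have lc: "(\<lambda>t. ?c (B t)) \<longlonglongrightarrow> ?c A" by (intro tendsto_prod lim)
    have cpos: "0 < ?c A" using sub n by (intro prod_pos) auto
    have "\<forall>\<^sub>F t in sequentially. 0 < ?c (B t)" using order_tendstoD(1)[OF lc cpos] .
    then have "\<forall>\<^sub>F t in sequentially. ?c (B t) * d ^ n \<le>
        cmod (poly (map_poly complex_of_real (chain_seq (B t) n)) z)"
    proof eventually_elim
      case (elim t)
      then have c: "coeff (chain_seq (B t) n) n \<noteq> 0" unfolding coeff_chain_seq by linarith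
      then have deg: "degree (chain_seq (B t) n) = n"
        using degree_chain_seq_le[of "B t" n] le_degree[OF c] by simp
      have "\<bar>lead_coeff (chain_seq (B t) n)\<bar> * d ^ degree (chain_seq (B t) n)
          \<le> cmod (poly (map_poly complex_of_real (chain_seq (B t) n)) z)"
        using zeros_in_interval_chain_seq_pos[OF uniB posB n] d
        by (intro norm_poly_ge) (auto simp: dist_norm)
      then show ?case unfolding deg coeff_chain_seq using elim by simp
    qed
    then have "?c A * d ^ n \<le> cmod (poly (map_poly complex_of_real (chain_seq A n)) z)"
      by (intro tendsto_le[OF _ tendsto_norm[OF plim] tendsto_mult_right[OF lc]]) auto
    moreover have "0 < ?c A * d ^ n" using cpos d(1) by simp
    ultimately show False using z by simp
  qed
  show "0 \<le> Im (poly (map_poly complex_of_real (chain_seq A (Suc n))) z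
        * cnj (poly (map_poly complex_of_real (chain_seq A n)) z))" if n: "Suc n \<le> N" and z: "0 < Im z"
  proof (rule tendsto_lowerbound)
    show "(\<lambda>t. Im (poly (map_poly complex_of_real (chain_seq (B t) (Suc n))) z
        * cnj (poly (map_poly complex_of_real (chain_seq (B t) n)) z)))
      \<longlonglongrightarrow> Im (poly (map_poly complex_of_real (chain_seq A (Suc n))) z
        * cnj (poly (map_poly complex_of_real (chain_seq A n)) z))"
      by (intro tendsto_Im tendsto_mult tendsto_cnj plim)
    have "0 \<le> Im (poly (map_poly complex_of_real (chain_seq (B t) (Suc n))) z
        * cnj (poly (map_poly complex_of_real (chain_seq (B t) n)) z))" for t
      by (rule rec_Im_nonneg[OF uniB posB _ poly_of_real_chain_seq z n]) auto
    then show "\<forall>\<^sub>F t in sequentially. 0 \<le> Im (poly (map_poly complex_of_real (chain_seq (B t) (Suc n))) z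
        * cnj (poly (map_poly complex_of_real (chain_seq (B t) n)) z))" by simp
  qed simp
qed

section \<open>Chains in weak upper homogeneous posets\<close>

lemma sorted_wrt_less_le_last:
  fixes c :: "'a::order list"
  assumes "sorted_wrt (<) c" "a \<in> set c"
  shows "a \<le> last c"
proof (cases c rule: rev_cases)
  case (snoc xs y)
  then show ?thesis using assms by (auto simp: sorted_wrt_append)
qed (use assms in simp)

context
  fixes P :: "'a::order set"
  assumes P: "wupho P"
begin

section \<open>Quasi-ranks\<close>

lemma qrank_ge: "y \<in> P \<Longrightarrow> k \<in> qrank_set P y \<Longrightarrow> k \<le> qrank P y"
  using P unfolding wupho_def qrank_def by (intro Max_ge) auto

lemma qrank_in_qrank_set: "y \<in> P \<Longrightarrow> qrank P y \<in> qrank_set P y"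
proof -
  assume y: "y \<in> P"
  then have "0 \<in> qrank_set P y" unfolding qrank_set_def by (auto intro!: exI[of _ "[y]"])
  then show ?thesis using P y unfolding wupho_def qrank_def by (intro Max_in) auto
qed

lemma qrank_less:
  assumes "y \<in> P" "z \<in> P" "y < z"
  shows "qrank P y < qrank P z"
proof -
  obtain c where c: "length c = Suc (qrank P y)" "set c \<subseteq> P" "sorted_wrt (<) c" "last c = y"
    using qrank_in_qrank_set[OF assms(1)] unfolding qrank_set_def by auto
  have "Suc (qrank P y) \<in> qrank_set P z"
    unfolding qrank_set_def mem_Collect_eq
    using c assms sorted_wrt_less_le_last[OF c(3)]
    by (intro exI[of _ "c @ [z]"]) (auto simp: sorted_wrt_append intro: le_less_trans)
  from qrank_ge[OF assms(2) this] show ?thesis by simp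
qed

lemma qrank_le: "y \<in> P \<Longrightarrow> z \<in> P \<Longrightarrow> y \<le> z \<Longrightarrow> qrank P y \<le> qrank P z"
  using qrank_less by (auto simp: order.order_iff_strict)

text \<open>The next-to-last element of a longest chain ending in \<open>y\<close> works: the
  truncated chain gives rank at least \<open>n\<close>, and \<open>qrank_less\<close> gives at most
  \<open>n\<close>.\<close>

lemma qrank_predecessor:
  assumes "y \<in> P" "qrank P y = Suc n"
  shows "\<exists>w\<in>P. w < y \<and> qrank P w = n"
proof -
  obtain c where c: "length c = Suc (Suc n)" "set c \<subseteq> P" "sorted_wrt (<) c" "last c = y"
    using qrank_in_qrank_set[OF assms(1)] assms(2) unfolding qrank_set_def by auto
  obtain b where b: "c = b @ [y]" using c by (metis append_butlast_last_id length_0_conv nat.distinct(1))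
  then have lb: "length b = Suc n" "b \<noteq> []" using c(1) by auto
  have w: "last b \<in> P" "last b < y" using c b lb by (auto simp: sorted_wrt_append)
  have "n \<in> qrank_set P (last b)"
    unfolding qrank_set_def mem_Collect_eq
    using c b lb by (intro exI[of _ b]) (auto simp: sorted_wrt_append)
  from qrank_ge[OF w(1) this] qrank_less[OF w(1) assms(1) w(2)] assms(2)
  show ?thesis using w by auto
qed

lemma qrank_descend:
  assumes "y \<in> P" "k \<le> qrank P y"
  shows "\<exists>w\<in>P. qrank P w = k"
  using assms
proof (induction "qrank P y - k" arbitrary: y)
  case (Suc d)
  then obtain n where n: "qrank P y = Suc n" by (cases "qrank P y") auto
  obtain w where w: "w \<in> P" "qrank P w = n" using qrank_predecessor[OF Suc.prems(1) n] by blast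
  show ?case by (rule Suc.hyps(1)[OF _ w(1)]) (use Suc.hyps(2) n w in auto)
qed auto

lemma exists_qrank:
  assumes "P \<noteq> {}" "enat n \<le> qrank_poset P"
  shows "\<exists>y\<in>P. qrank P y = n"
proof -
  have "\<exists>y\<in>P. n \<le> qrank P y"
  proof (rule ccontr)
    assume "\<not> ?thesis"
    then have *: "\<forall>y\<in>P. qrank P y < n" by (auto simp: not_le)
    \<comment> \<open>This makes \<open>n - 1\<close> a proper predecessor, so ranks below
      \<open>n\<close> bound the supremum by \<open>n - 1\<close>.\<close>
    then have "0 < n" using assms(1) by auto
    have "qrank_poset P \<le> enat (n - 1)"
      unfolding qrank_poset_def using * by (intro SUP_least) auto
    then show False using assms(2) \<open>0 < n\<close> by (metis diff_less enat_ord_simps(1) less_numeral_extra(1) not_le order.trans)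
  qed
  then show ?thesis using qrank_descend by blast
qed

lemma qrank_minimal: "minimal_in P x \<Longrightarrow> qrank P x = 0"
  using qrank_predecessor[of x] unfolding minimal_in_def by (cases "qrank P x") blast+

lemma finite_upper_level: "finite (upper_level P y n)"
proof (rule finite_subset)
  show "upper_level P y n \<subseteq> {z \<in> P. qrank P z = n}" unfolding upper_level_def by auto
  show "finite {z \<in> P. qrank P z = n}" using P unfolding wupho_def by blast
qed

section \<open>The matrix of a poset\<close>

lemma unitriangular_Rbar:
  assumes "P \<noteq> {}" "enat N \<le> qrank_poset P"
  shows "unitriangular N (\<lambda>n k. real (Rbar P n k))"
  unfolding unitriangular_def
proof (intro conjI allI impI)
  have ex: "\<exists>y\<in>P. qrank P y = n" if "n \<le> N" for n
    using exists_qrank[OF assms(1), of n] assms(2) that by (meson enat_ord_simps(1) order.trans)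
  show "real (Rbar P i i) = 1" if "i \<le> N" for i
  proof -
    obtain y where y: "y \<in> P" "qrank P y = i" using ex \<open>i \<le> N\<close> by blast
    have "upper_level P y i = {y}"
      using y qrank_less[OF y(1)] unfolding upper_level_def
      by (fastforce simp: order.order_iff_strict)
    then show ?thesis using Rbar_eq[OF P y, of i] by simp
  qed
  show "real (Rbar P i j) = 0" if "i < j" "j \<le> N" for i j
  proof -
    \<comment> \<open>\<open>Rbar_eq\<close> covers entries on and below the diagonal only, so above
      it the chosen element itself is examined.\<close>
    define y where "y = (SOME y. y \<in> P \<and> qrank P y = j)"
    have y: "y \<in> P \<and> qrank P y = j"
      unfolding y_def by (rule someI_ex) (use ex[OF \<open>j \<le> N\<close>] in blast)
    have "upper_level P y i = {}"
      using y qrank_le[of y] \<open>i < j\<close> unfolding upper_level_def by fastforce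
    then show ?thesis unfolding Rbar_def y_def[symmetric] by simp
  qed
qed

lemma Rbar_Suc_pos:
  assumes "P \<noteq> {}" "enat (Suc k) \<le> qrank_poset P"
  shows "0 < Rbar P (Suc k) k"
proof -
  obtain y where y: "y \<in> P" "qrank P y = Suc k" using exists_qrank[OF assms] by blast
  obtain w where w: "w \<in> P" "w < y" "qrank P w = k" using qrank_predecessor[OF y] by blast
  have "y \<in> upper_level P w (Suc k)" using y w unfolding upper_level_def by auto
  then have "0 < card (upper_level P w (Suc k))" using finite_upper_level card_gt_0_iff by blast
  then show ?thesis using Rbar_eq[OF P w(1,3)] by simp
qed

context
  fixes x :: 'a
  assumes x: "minimal_in P x"
begin

section \<open>Counting chains\<close>

lemma chains_from_0: "chains_from P x 0 n = (if n = 0 then {[x]} else {})"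
  using x qrank_minimal[OF x] unfolding chains_from_def minimal_in_def
  by (auto simp: length_Suc_conv)

text \<open>Removing the last element inverts appending. The rank \<open>k\<close> of the remaining
  last element is below \<open>n\<close> by \<open>qrank_less\<close>; conversely
  \<open>k < n\<close> makes the weak inequality in \<open>upper_level\<close> strict.\<close>

lemma chains_from_Suc:
  "chains_from P x (Suc j) n =
    (\<lambda>(c, z). c @ [z]) ` (SIGMA c:(\<Union>k<n. chains_from P x j k). upper_level P (last c) n)"
    (is "?L = ?f ` ?R")
proof (intro equalityI subsetI)
  fix d assume "d \<in> ?L"
  then have d: "length d = Suc (Suc j)" "set d \<subseteq> P" "sorted_wrt (<) d" "hd d = x" "qrank P (last d) = n"
    unfolding chains_from_def by auto
  obtain c z where cz: "d = c @ [z]"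
    using d(1) by (metis append_butlast_last_id length_0_conv nat.distinct(1))
  then have "c \<noteq> []" using d(1) by auto
  have last: "last c \<in> P" "last c < z" "z \<in> P" using d cz \<open>c \<noteq> []\<close> by (auto simp: sorted_wrt_append)
  then have "qrank P (last c) < n" using qrank_less d(5) cz by auto
  then have "(c, z) \<in> ?R"
    using d cz last less_imp_le[OF last(2)] \<open>c \<noteq> []\<close> unfolding chains_from_def upper_level_def
    by (auto simp: sorted_wrt_append)
  then show "d \<in> ?f ` ?R" using cz by force
next
  fix d assume "d \<in> ?f ` ?R"
  then obtain c z k where cz: "d = c @ [z]" "k < n" "c \<in> chains_from P x j k" "z \<in> upper_level P (last c) n"
    by auto
  then have c: "length c = Suc j" "set c \<subseteq> P" "sorted_wrt (<) c" "hd c = x" "qrank P (last c) = k" "c \<noteq> []"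
    and z: "z \<in> P" "last c \<le> z" "qrank P z = n"
    unfolding chains_from_def upper_level_def by auto
  have "last c < z" using z c(5) cz(2) by (auto simp: order.order_iff_strict)
  then show "d \<in> ?L"
    using c z sorted_wrt_less_le_last[OF c(3)] unfolding chains_from_def cz(1)
    by (auto simp: sorted_wrt_append intro: le_less_trans)
qed

lemma finite_chains_from: "finite (chains_from P x j n)"
proof (induction j arbitrary: n)
  case (Suc j)
  then show ?case unfolding chains_from_Suc
    by (intro finite_imageI finite_SigmaI finite_UN_I finite_upper_level) auto
qed (simp add: chains_from_0)

text \<open>The number of extensions of a chain depends only on the rank of its last element, by
  upper homogeneity. Chains whose last elements differ in rank are distinct.\<close>

lemma card_chains_from_Suc:
  "card (chains_from P x (Suc j) n) = (\<Sum>k<n. Rbar P n k * card (chains_from P x j k))"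
proof -
  have "card (chains_from P x (Suc j) n) =
      card (SIGMA c:(\<Union>k<n. chains_from P x j k). upper_level P (last c) n)"
    unfolding chains_from_Suc by (intro card_image) (auto simp: inj_on_def)
  also have "\<dots> = (\<Sum>c\<in>(\<Union>k<n. chains_from P x j k). card (upper_level P (last c) n))"
    by (intro card_SigmaI) (auto intro: finite_chains_from finite_upper_level)
  also have "\<dots> = (\<Sum>k<n. \<Sum>c\<in>chains_from P x j k. card (upper_level P (last c) n))"
    using finite_chains_from by (intro sum.UNION_disjoint) (auto, auto simp: chains_from_def)
  also have "\<dots> = (\<Sum>k<n. Rbar P n k * card (chains_from P x j k))"
  proof (intro sum.cong refl)
    fix k assume k: "k \<in> {..<n}"
    have "card (upper_level P (last c) n) = Rbar P n k" if "c \<in> chains_from P x j k" for c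
    proof (rule Rbar_eq[OF P, symmetric])
      have "c \<noteq> []" "set c \<subseteq> P" using that unfolding chains_from_def by auto
      then show "last c \<in> P" using last_in_set by blast
      show "qrank P (last c) = k" using that unfolding chains_from_def by auto
    qed (use k in auto)
    then show "(\<Sum>c\<in>chains_from P x j k. card (upper_level P (last c) n))
        = Rbar P n k * card (chains_from P x j k)" by simp
  qed
  finally show ?thesis .
qed

lemma coeff_chain_poly: "coeff (chain_poly P x n) j = real (card (chains_from P x j n))"
proof (cases "n = 0")
  case True
  then show ?thesis
    using chains_from_empty[OF P, of 0 j x] by (cases j) (auto simp: chain_poly_def chains_from_0)
next
  case False
  then have "coeff (chain_poly P x n) j = (\<Sum>i=1..n. if i = j then real (card (chains_from P x i n)) else 0)"
    by (simp add: chain_poly_def coeff_sum)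
  also have "\<dots> = (if j \<in> {1..n} then real (card (chains_from P x j n)) else 0)"
    by (simp add: sum.delta)
  also have "\<dots> = real (card (chains_from P x j n))"
    using chains_from_empty[OF P, of n j x] False by (cases j) (auto simp: chains_from_0)
  finally show ?thesis .
qed

lemma chain_poly_eq_chain_seq: "chain_poly P x n = chain_seq (\<lambda>n k. real (Rbar P n k)) n"
proof (induction n rule: less_induct)
  case (less n)
  show ?case
  proof (cases n)
    case (Suc m)
    have "chain_poly P x n = pCons 0 (\<Sum>k\<le>m. Polynomial.smult (real (Rbar P n k)) (chain_poly P x k))"
    proof (rule poly_eqI)
      fix j
      show "coeff (chain_poly P x n) j =
          coeff (pCons 0 (\<Sum>k\<le>m. Polynomial.smult (real (Rbar P n k)) (chain_poly P x k))) j"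
        using Suc by (cases j) (simp_all add: coeff_chain_poly coeff_sum chains_from_0
          card_chains_from_Suc lessThan_Suc_atMost)
    qed
    then show ?thesis using less Suc by simp
  qed (simp add: chain_poly_def)
qed

end

end

theorem theorem5p21:
  fixes P :: "'a::order set" and x :: 'a
  assumes "wupho P" and "TN_bar P" and "minimal_in P x"
  shows "(\<forall>n. enat n \<le> qrank_poset P \<longrightarrow>
           (\<forall>z::complex. poly (map_poly complex_of_real (chain_poly P x n)) z = 0 \<longrightarrow>
              (\<exists>r::real. z = complex_of_real r \<and> -1 \<le> r \<and> r \<le> 0))) \<and>
         (\<forall>n. enat (n + 1) \<le> qrank_poset P \<longrightarrow>
           chain_poly P x n \<prec>\<^sub>I chain_poly P x (n + 1))"
proof -
  let ?A = "\<lambda>n k. real (Rbar P n k)"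
  have ne: "P \<noteq> {}" using assms(3) unfolding minimal_in_def by auto
  \<comment> \<open>Minors of a truncation are minors of the whole matrix; working with finite
    \<open>N\<close> thus also covers posets of infinite rank.\<close>
  have TN: "totally_nonneg (enat N) ?A" if "enat N \<le> qrank_poset P" for N
    using assms(2) that unfolding TN_bar_def totally_nonneg_def by (meson order.trans)
  have sub: "0 < ?A (Suc k) k" if "enat N \<le> qrank_poset P" "k < N" for N k
  proof -
    have "enat (Suc k) \<le> qrank_poset P" using that by (meson Suc_leI enat_ord_simps(1) order.trans)
    then show ?thesis using Rbar_Suc_pos[OF assms(1) ne] by simp
  qed
  note seq = chain_poly_eq_chain_seq[OF assms(1,3)]
  have zeros: "zeros_in_interval (chain_poly P x n)" if "enat N \<le> qrank_poset P" "n \<le> N" for n N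
    unfolding seq
    by (rule chain_seq_totally_nonneg(1)[OF TN[OF that(1)] unitriangular_Rbar[OF assms(1) ne that(1)]
      sub[OF that(1)] that(2)])
  have "chain_poly P x n \<prec>\<^sub>I chain_poly P x (n + 1)" if N: "enat (n + 1) \<le> qrank_poset P" for n
  proof (rule interlaces_if_Im_nonneg)
    show "real_rooted (chain_poly P x n)" "real_rooted (chain_poly P x (n + 1))"
      by (rule real_rooted_if_zeros_in_interval[OF zeros[OF N]], simp)+
    have lead: "degree (chain_poly P x m) = m" "0 < lead_coeff (chain_poly P x m)" if "m \<le> n + 1" for m
      unfolding seq using chain_seq_lead[of m ?A] sub[OF N] that by auto
    show "0 < lead_coeff (chain_poly P x n)" "0 < lead_coeff (chain_poly P x (n + 1))"
      "degree (chain_poly P x (n + 1)) = degree (chain_poly P x n) + 1"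
      using lead[of n] lead[of "n + 1"] by auto
    show "0 \<le> Im (poly (map_poly complex_of_real (chain_poly P x (n + 1))) z
        * cnj (poly (map_poly complex_of_real (chain_poly P x n)) z))" if "0 < Im z" for z
      unfolding seq
      using chain_seq_totally_nonneg(2)[OF TN[OF N] unitriangular_Rbar[OF assms(1) ne N] sub[OF N], of n z] that
      by simp
  qed
  then show ?thesis using zeros unfolding zeros_in_interval_def by blast
qed

end
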